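(* Let $A$ be a quasi-Hopf (super)algebra and suppose $c_1\in A$ is even and invariant. Set $$C_1=\sum_\nu \bar X_\nu\, c_1\, S(\bar Y_\nu)\,\alpha\,\bar Z_\nu .$$ Then: (i) $aC_1=C_1a$ for all $a\in A$, i.e. $C_1$ is central; (ii) $c_1=C_1\beta=\beta C_1$; (iii) $C_1=\sum_\nu S(X_\nu)\,\alpha\, Y_\nu\, c_1\, S(Z_\nu)$.
   Context: A quasi-Hopf (super)algebra $(A,\Delta,\epsilon,\Phi)$ is a unital associative $\mathbb Z_2$-graded algebra $A$ over a field $K$ (the ungraded case being $A$ concentrated in degree $0$; $[a]\in\mathbb Z_2$ is the degree of a homogeneous $a$; sign formulas are stated for homogeneous elements and extended linearly), with grading-preserving algebra homomorphisms $\epsilon:A\to K$, $\Delta:A\to A\otimes A$, an invertible homogeneous $\Phi\in A\otimes A\otimes A$, a graded algebra anti-homomorphism $S:A\to A$ (grading preserving, $S(ab)=(-1)^{[a][b]}S(b)S(a)$) and homogeneous $\alpha,\beta\in A$. Tensor products are multiplied by $(a\otimes b)(a'\otimes b')=(-1)^{[b][a']}aa'\otimes bb'$. Write $\Phi=\sum_\nu X_\nu\otimes Y_\nu\otimes Z_\nu$, $\Phi^{-1}=\sum_\nu\bar X_\nu\otimes\bar Y_\nu\otimes\bar Z_\nu$, $\Delta(a)=\sum a_{(1)}\otimes a_{(2)}$ (homogeneous components). The axioms are, for all $a\in A$: $(1\otimes\Delta)\Delta(a)=\Phi^{-1}(\Delta\otimes1)\Delta(a)\Phi$; $(\Delta\otimes1\otimes1)\Phi\cdot(1\otimes1\otimes\Delta)\Phi=(\Phi\otimes1)\cdot(1\otimes\Delta\otimes1)\Phi\cdot(1\otimes\Phi)$;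 $(\epsilon\otimes1)\Delta=1=(1\otimes\epsilon)\Delta$; $(1\otimes\epsilon\otimes1)\Phi=1$; $\sum S(a_{(1)})\alpha a_{(2)}=\epsilon(a)\alpha$; $\sum a_{(1)}\beta S(a_{(2)})=\epsilon(a)\beta$; $\sum\bar X_\nu\beta S(\bar Y_\nu)\alpha\bar Z_\nu=1$; $\sum S(X_\nu)\alpha Y_\nu\beta S(Z_\nu)=1$. These imply that $\Phi,\alpha,\beta$ are even. An element $c\in A$ is called invariant if $\sum a_{(1)}\,c\,S(a_{(2)})(-1)^{[c][a_{(2)}]}=\epsilon(a)c$ for all $a\in A$. *)

theory Defs
  imports Complex_Main "HOL-Library.Poly_Mapping" "HOL-Library.Z2"
begin

section \<open>Formal tensors\<close>

text \<open>
  A formal tensor is an element of the free vector space on the lists over \<^typ>\<open>'a\<close>; the basis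
  vector of \<open>[a\<^sub>1, \<dots>, a\<^sub>n]\<close> stands for the pure tensor \<open>a\<^sub>1 \<otimes> \<dots> \<otimes> a\<^sub>n\<close>. The \<open>n\<close>-th tensor power
  of an algebra is the quotient of the formal tensors of length \<open>n\<close> by the multilinearity
  relations (\<open>teq\<close> below). The scalar multiplication is a locale parameter, so this quotient is
  not a HOL type: elements of a tensor power are given by representatives, and every equation
  between them is stated modulo \<open>teq\<close>. Formal tensors of length 0 and 1 represent the
  ground field and the algebra itself, so that identifications such as \<open>K \<otimes> A = A\<close> are
  concatenations of lists.
\<close>

type_synonym ('a, 'k) tensor = "'a list \<Rightarrow>\<^sub>0 'k"

definition tscale :: "'k::field \<Rightarrow> ('a, 'k) tensor \<Rightarrow> ('a, 'k) tensor" where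
  "tscale k t = Poly_Mapping.map ((*) k) t"

definition pure :: "'a list \<Rightarrow> ('a, 'k::field) tensor" where
  "pure xs = Poly_Mapping.single xs 1"

definition has_length :: "nat \<Rightarrow> ('a, 'k::field) tensor \<Rightarrow> bool" where
  "has_length n t \<longleftrightarrow> (\<forall>xs\<in>Poly_Mapping.keys t. length xs = n)"

text \<open>Linear extension of a map on basis vectors to a space with scalar multiplication \<open>s\<close>.\<close>

definition lin_ext ::
    "('k::field \<Rightarrow> 'b::ab_group_add \<Rightarrow> 'b) \<Rightarrow> ('a list \<Rightarrow> 'b) \<Rightarrow> ('a, 'k) tensor \<Rightarrow> 'b" where
  "lin_ext s f t = (\<Sum>xs\<in>Poly_Mapping.keys t. s (Poly_Mapping.lookup t xs) (f xs))"

definition tprod :: "('a, 'k::field) tensor \<Rightarrow> ('a, 'k) tensor \<Rightarrow> ('a, 'k) tensor"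
    (infixr \<open>\<otimes>\<^sub>t\<close> 75) where
  "s \<otimes>\<^sub>t t = lin_ext tscale (\<lambda>xs. lin_ext tscale (\<lambda>ys. pure (xs @ ys)) t) s"

text \<open>
  \<open>tmap [f\<^sub>1, \<dots>, f\<^sub>n]\<close> is \<open>f\<^sub>1 \<otimes> \<dots> \<otimes> f\<^sub>n\<close>, where each \<open>f\<^sub>i\<close> maps the algebra to some tensor power.
  No signs occur because it is only used for grading-preserving maps.
\<close>

definition tmap ::
    "('a \<Rightarrow> ('a, 'k::field) tensor) list \<Rightarrow> ('a, 'k) tensor \<Rightarrow> ('a, 'k) tensor" where
  "tmap fs t =
     lin_ext tscale (\<lambda>xs. foldr (\<otimes>\<^sub>t) (map2 (\<lambda>f x. f x) fs xs) (pure [])) t"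

abbreviation id_leg :: "'a \<Rightarrow> ('a, 'k::field) tensor" where
  "id_leg a \<equiv> pure [a]"

abbreviation scalar_leg :: "('a \<Rightarrow> 'k::field) \<Rightarrow> 'a \<Rightarrow> ('a, 'k) tensor" where
  "scalar_leg e a \<equiv> tscale (e a) (pure [])"

text \<open>The sign \<open>(-1)\<^bsup>ij\<^esup>\<close> for \<open>i, j\<close> in \<open>\<int>/2\<close>.\<close>

definition ksign :: "bit \<Rightarrow> bit \<Rightarrow> 'k::field" where
  "ksign i j = (if i = 1 \<and> j = 1 then - 1 else 1)"

text \<open>
  The sign in \<open>(a\<^sub>1 \<otimes> \<dots> \<otimes> a\<^sub>n)(b\<^sub>1 \<otimes> \<dots> \<otimes> b\<^sub>n) = \<plusminus> a\<^sub>1b\<^sub>1 \<otimes> \<dots> \<otimes> a\<^sub>nb\<^sub>n\<close> for degrees \<open>ds\<close> of the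
  \<open>a\<^sub>i\<close> and \<open>es\<close> of the \<open>b\<^sub>j\<close>: every \<open>b\<^sub>j\<close> passes all \<open>a\<^sub>i\<close> with \<open>j < i\<close>.
\<close>

definition mult_sign :: "bit list \<Rightarrow> bit list \<Rightarrow> 'k::field" where
  "mult_sign ds es = (\<Prod>i<length ds. \<Prod>j<i. ksign (ds ! i) (es ! j))"

section \<open>Superalgebras and their tensor powers\<close>

locale superalgebra = vector_space scale
  for scale :: "'k::field \<Rightarrow> 'a::ring_1 \<Rightarrow> 'a" (infixr \<open>*s\<close> 75) +
  fixes gr :: "bit \<Rightarrow> 'a set"
  assumes scale_mult_left: "(k *s a) * b = k *s (a * b)"
    and scale_mult_right: "a * (k *s b) = k *s (a * b)"
    and subspace_gr: "subspace (gr i)"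
    and gr_Int: "gr 0 \<inter> gr 1 = {0}"
    and gr_decomp: "\<exists>x\<in>gr 0. \<exists>y\<in>gr 1. a = x + y"
    and one_gr: "1 \<in> gr 0"
    and mult_gr: "a \<in> gr i \<Longrightarrow> b \<in> gr j \<Longrightarrow> a * b \<in> gr (i + j)"
begin

definition hcomp :: "bit \<Rightarrow> 'a \<Rightarrow> 'a" where
  "hcomp i a = (THE x. x \<in> gr i \<and> a - x \<in> gr (i + 1))"

definition multilinear_relations :: "('a, 'k) tensor set" where
  "multilinear_relations =
     {pure (xs @ (a + b) # ys) - pure (xs @ a # ys) - pure (xs @ b # ys) | xs a b ys. True} \<union>
     {pure (xs @ (k *s a) # ys) - tscale k (pure (xs @ a # ys)) | xs k a ys. True}"

definition teq :: "('a, 'k) tensor \<Rightarrow> ('a, 'k) tensor \<Rightarrow> bool" (infix \<open>\<approx>\<close> 50) where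
  "s \<approx> t \<longleftrightarrow> s - t \<in> module.span tscale multilinear_relations"

text \<open>
  Product of pure tensors: both factors are decomposed into pure tensors of homogeneous elements,
  to which the sign rule applies.
\<close>

definition pure_mult :: "'a list \<Rightarrow> 'a list \<Rightarrow> ('a, 'k) tensor" where
  "pure_mult xs ys =
     (\<Sum>ds\<in>set (List.n_lists (length xs) [0, 1]). \<Sum>es\<in>set (List.n_lists (length ys) [0, 1]).
        tscale (mult_sign ds es) (pure (map2 (*) (map2 hcomp ds xs) (map2 hcomp es ys))))"

definition tmult :: "('a, 'k) tensor \<Rightarrow> ('a, 'k) tensor \<Rightarrow> ('a, 'k) tensor" (infixl \<open>\<bullet>\<close> 70) where
  "s \<bullet> t = lin_ext tscale (\<lambda>xs. lin_ext tscale (\<lambda>ys. pure_mult xs ys) t) s"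

definition homogeneous_tensor :: "bit \<Rightarrow> ('a, 'k) tensor \<Rightarrow> bool" where
  "homogeneous_tensor i t \<longleftrightarrow>
     (\<exists>s. s \<approx> t \<and>
        (\<forall>xs\<in>Poly_Mapping.keys s. \<exists>ds. list_all2 (\<lambda>x d. x \<in> gr d) xs ds \<and> sum_list ds = i))"

text \<open>
  For \<open>t = \<Sum> x \<otimes> y\<close>, \<open>eval2 f t\<close> is \<open>\<Sum> f x y\<close>; similarly for \<open>eval3\<close>. For multilinear \<open>f\<close> this
  only depends on the class of \<open>t\<close> modulo \<open>\<approx>\<close>.
\<close>

definition eval2 :: "('a \<Rightarrow> 'a \<Rightarrow> 'a) \<Rightarrow> ('a, 'k) tensor \<Rightarrow> 'a" where
  "eval2 f t = lin_ext scale (\<lambda>xs. f (xs ! 0) (xs ! 1)) t"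

definition eval3 :: "('a \<Rightarrow> 'a \<Rightarrow> 'a \<Rightarrow> 'a) \<Rightarrow> ('a, 'k) tensor \<Rightarrow> 'a" where
  "eval3 f t = lin_ext scale (\<lambda>xs. f (xs ! 0) (xs ! 1) (xs ! 2)) t"

end

section \<open>Quasi-Hopf superalgebras\<close>

locale quasi_hopf_superalgebra = superalgebra scale gr
  for scale :: "'k::field \<Rightarrow> 'a::ring_1 \<Rightarrow> 'a" (infixr \<open>*s\<close> 75)
    and gr :: "bit \<Rightarrow> 'a set" +
  fixes \<Delta> :: "'a \<Rightarrow> ('a, 'k) tensor"
    and \<epsilon> :: "'a \<Rightarrow> 'k"
    and \<Phi> \<Phi>inv :: "('a, 'k) tensor"
    and S :: "'a \<Rightarrow> 'a"
    and \<alpha> \<beta> :: 'a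
  assumes counit_linear: "Vector_Spaces.linear scale (*) \<epsilon>"
    and counit_mult: "\<epsilon> (a * b) = \<epsilon> a * \<epsilon> b"
    and counit_one: "\<epsilon> 1 = 1"
    and counit_gr: "a \<in> gr 1 \<Longrightarrow> \<epsilon> a = 0"
    and comult_length: "has_length 2 (\<Delta> a)"
    and comult_add: "\<Delta> (a + b) \<approx> \<Delta> a + \<Delta> b"
    and comult_scale: "\<Delta> (k *s a) \<approx> tscale k (\<Delta> a)"
    and comult_mult: "\<Delta> (a * b) \<approx> \<Delta> a \<bullet> \<Delta> b"
    and comult_one: "\<Delta> 1 \<approx> pure [1, 1]"
    and comult_gr: "a \<in> gr i \<Longrightarrow> homogeneous_tensor i (\<Delta> a)"
    and coassociator_length: "has_length 3 \<Phi>" "has_length 3 \<Phi>inv"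
    and coassociator_inverse: "\<Phi> \<bullet> \<Phi>inv \<approx> pure [1, 1, 1]" "\<Phi>inv \<bullet> \<Phi> \<approx> pure [1, 1, 1]"
    and coassociator_homogeneous: "\<exists>i. homogeneous_tensor i \<Phi>"
    and antipode_linear: "Vector_Spaces.linear scale scale S"
    and antipode_gr: "a \<in> gr i \<Longrightarrow> S a \<in> gr i"
    and antipode_mult: "a \<in> gr i \<Longrightarrow> b \<in> gr j \<Longrightarrow> S (a * b) = ksign i j *s (S b * S a)"
    and antipode_one: "S 1 = 1"
    and alpha_homogeneous: "\<exists>i. \<alpha> \<in> gr i"
    and beta_homogeneous: "\<exists>i. \<beta> \<in> gr i"
    and quasi_coassoc:
      "tmap [id_leg, \<Delta>] (\<Delta> a) \<approx> \<Phi>inv \<bullet> tmap [\<Delta>, id_leg] (\<Delta> a) \<bullet> \<Phi>"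
    and pentagon:
      "tmap [\<Delta>, id_leg, id_leg] \<Phi> \<bullet> tmap [id_leg, id_leg, \<Delta>] \<Phi>
         \<approx> (\<Phi> \<otimes>\<^sub>t pure [1]) \<bullet> tmap [id_leg, \<Delta>, id_leg] \<Phi> \<bullet> (pure [1] \<otimes>\<^sub>t \<Phi>)"
    and counit_left: "tmap [scalar_leg \<epsilon>, id_leg] (\<Delta> a) \<approx> pure [a]"
    and counit_right: "tmap [id_leg, scalar_leg \<epsilon>] (\<Delta> a) \<approx> pure [a]"
    and counit_coassociator: "tmap [id_leg, scalar_leg \<epsilon>, id_leg] \<Phi> \<approx> pure [1, 1]"
    and antipode_alpha: "eval2 (\<lambda>x y. S x * \<alpha> * y) (\<Delta> a) = \<epsilon> a *s \<alpha>"
    and antipode_beta: "eval2 (\<lambda>x y. x * \<beta> * S y) (\<Delta> a) = \<epsilon> a *s \<beta>"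
    and antipode_coassociator_inv: "eval3 (\<lambda>x y z. x * \<beta> * S y * \<alpha> * z) \<Phi>inv = 1"
    and antipode_coassociator: "eval3 (\<lambda>x y z. S x * \<alpha> * y * \<beta> * S z) \<Phi> = 1"
begin

text \<open>
  Invariance of \<open>c\<close>: \<open>\<Sum> (-1)\<^bsup>[c][y]\<^esup> x c S(y) = \<epsilon>(a)c\<close> for \<open>\<Delta>(a) = \<Sum> x \<otimes> y\<close>, extended linearly from
  homogeneous \<open>c\<close> and \<open>y\<close>.
\<close>

definition invariant :: "'a \<Rightarrow> bool" where
  "invariant c \<longleftrightarrow>
     (\<forall>a. eval2 (\<lambda>x y. \<Sum>i\<in>{0, 1}. \<Sum>j\<in>{0, 1}. ksign i j *s (x * hcomp i c * S (hcomp j y))) (\<Delta> a)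
        = \<epsilon> a *s c)"

end

end

theory Submission
  imports Defs
begin

text \<open>
  Write \<open>\<Psi>\<close> for \<open>\<Phi>\<close> inverse and consider, for elements \<open>c\<close> and \<open>b\<close>, the zigzag
  \<open>x \<otimes> y \<otimes> z \<otimes> w \<mapsto> x c S(y) \<alpha> z b S(w)\<close>. Every turn of a zigzag absorbs a coproduct: the antipode
  axiom for \<open>\<alpha>\<close> turns a factor \<open>\<Delta>(a)\<close> that is multiplied from the left into the two middle slots
  into \<open>\<epsilon>(a)\<close>, and if \<open>c\<close> (or \<open>b\<close>) is invariant, then the same happens to a factor \<open>\<Delta>(a)\<close> multiplied
  from the right into the first (or last) two slots. For \<open>b = 1\<close> and \<open>w = 1\<close> the zigzag becomes
  the cap \<open>x \<otimes> y \<otimes> z \<mapsto> x c S(y) \<alpha> z\<close>, and \<open>C\<close> is the value of the cap at \<open>\<Psi>\<close>.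
  
  \<^item> The cap maps both sides of \<open>(1 \<otimes> \<Delta>)\<Delta>(a) \<Psi> = \<Psi> (\<Delta> \<otimes> 1)\<Delta>(a)\<close>, which is quasi-coassociativity, to
    \<open>a C\<close> and \<open>C a\<close>. So \<open>C\<close> is central (\<open>cap_central\<close>).
  \<^item> The pentagon equation says that
    \<open>(\<Psi> \<otimes> 1) (\<Delta> \<otimes> 1 \<otimes> 1)\<Phi> (1 \<otimes> 1 \<otimes> \<Delta>)\<Phi> = (1 \<otimes> \<Delta> \<otimes> 1)\<Phi> (1 \<otimes> \<Phi>)\<close>.
    In the zigzag with \<open>b = \<beta>\<close> every coproduct in this equation is absorbed, which leaves
    a copy of \<open>\<Phi>\<close> with \<open>\<epsilon>\<close> on one of its legs, and this is \<open>1 \<otimes> 1\<close>. What remains is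
    the zigzag at \<open>\<Psi> \<otimes> 1\<close>, which is \<open>C \<beta>\<close>, and at \<open>1 \<otimes> \<Phi>\<close>, which is \<open>c\<close> by the last antipode axiom
    (\<open>cap_beta\<close>).
  \<^item> Since \<open>c = C \<beta>\<close> with \<open>C\<close> central, \<open>\<Sum> S(X) \<alpha> Y c S(Z) = C \<Sum> S(X) \<alpha> Y \<beta> S(Z) = C\<close>.
  
  The axioms normalise only the middle leg of \<open>\<Phi>\<close>. That \<open>\<epsilon>\<close> on the first or the last leg also gives
  \<open>1 \<otimes> 1\<close> follows from the pentagon equation with \<open>\<epsilon>\<close> in its second or third slot, after
  cancelling \<open>\<Phi>\<close> (\<open>lin_ext_coassociator_counit_first\<close>, \<open>lin_ext_coassociator_counit_last\<close>).
  
  The signs disappear for one reason. When the two legs \<open>p\<close>, \<open>q\<close> of \<open>\<Delta>(a)\<close> are absorbed, the Koszul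
  signs and the sign of the antipode combine to a sign in which only \<open>[p] + [q] = [a]\<close> occurs, so it can
  be taken out of the sum; and \<open>\<epsilon>(a) = 0\<close> if \<open>a\<close> is odd.
  
  Equations between formal tensors hold up to multilinearity only. They are therefore used in
  the form that all multilinear functions with values in the algebra agree on the two
  sides (\<open>mequiv\<close>). Identities between multilinear functions are proved on homogeneous elements.
\<close>

\<comment> \<open>This simp rule would rewrite sums of degrees into an opaque Boolean form.\<close>
declare add_bit_eq_xor [simp del]

section \<open>Linear extension\<close>

lemma lookup_tscale: "Poly_Mapping.lookup (tscale k t) xs = k * Poly_Mapping.lookup t xs"
  by (simp add: tscale_def map.rep_eq when_def)

interpretation tensor: vector_space "tscale :: 'k::field \<Rightarrow> ('a, 'k) tensor \<Rightarrow> _"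
  by unfold_locales
    (auto intro!: poly_mapping_eqI simp: lookup_tscale lookup_add algebra_simps)

context vector_space
begin

lemma lin_ext_superset:
  assumes "finite X" "Poly_Mapping.keys t \<subseteq> X"
  shows "lin_ext scale f t = (\<Sum>xs\<in>X. scale (Poly_Mapping.lookup t xs) (f xs))"
  unfolding lin_ext_def using assms
  by (intro sum.mono_neutral_left) (auto simp: in_keys_iff)

lemma lin_ext_add: "lin_ext scale f (s + t) = lin_ext scale f s + lin_ext scale f t"
proof -
  let ?X = "Poly_Mapping.keys s \<union> Poly_Mapping.keys t"
  have *: "finite ?X" "Poly_Mapping.keys (s + t) \<subseteq> ?X" "Poly_Mapping.keys s \<subseteq> ?X"
    "Poly_Mapping.keys t \<subseteq> ?X"
    using Poly_Mapping.keys_add[of s t] by auto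
  show ?thesis
    by (simp add: lin_ext_superset[OF *(1,2)] lin_ext_superset[OF *(1,3)]
        lin_ext_superset[OF *(1,4)] lookup_add scale_left_distrib sum.distrib)
qed

lemma lin_ext_tscale: "lin_ext scale f (tscale k t) = scale k (lin_ext scale f t)"
proof -
  have "Poly_Mapping.keys (tscale k t) \<subseteq> Poly_Mapping.keys t"
    by (auto simp: in_keys_iff lookup_tscale)
  from lin_ext_superset[OF finite_keys this] show ?thesis
    by (simp add: lookup_tscale scale_sum_right lin_ext_def)
qed

lemma lin_ext_zero [simp]: "lin_ext scale f 0 = 0"
  by (simp add: lin_ext_def)

lemma lin_ext_diff: "lin_ext scale f (s - t) = lin_ext scale f s - lin_ext scale f t"
  using lin_ext_add[of f "s - t" t] by (simp add: algebra_simps)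

lemma lin_ext_sum: "lin_ext scale f (\<Sum>i\<in>I. t i) = (\<Sum>i\<in>I. lin_ext scale f (t i))"
  by (induction I rule: infinite_finite_induct) (auto simp: lin_ext_add)

lemma lin_ext_pure [simp]: "lin_ext scale f (pure xs) = f xs"
  by (simp add: lin_ext_def pure_def)

lemma lin_ext_lin_ext:
  "lin_ext scale f (lin_ext tscale g t) = lin_ext scale (\<lambda>xs. lin_ext scale f (g xs)) t"
proof -
  have "lin_ext scale f (lin_ext tscale g t)
      = (\<Sum>xs\<in>Poly_Mapping.keys t. scale (Poly_Mapping.lookup t xs) (lin_ext scale f (g xs)))"
    by (simp only: lin_ext_def[of tscale] lin_ext_sum lin_ext_tscale)
  thus ?thesis by (simp only: lin_ext_def[of scale "\<lambda>xs. lin_ext scale f (g xs)"])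
qed

lemma lin_ext_scale_fun:
  "lin_ext scale (\<lambda>xs. scale k (f xs)) t = scale k (lin_ext scale f t)"
  by (simp add: lin_ext_def scale_sum_right mult.commute)

text \<open>
  Fubini for formal tensors, which are finite sums.
\<close>

lemma lin_ext_swap:
  "lin_ext scale (\<lambda>xs. lin_ext scale (\<lambda>ys. f xs ys) t) s
     = lin_ext scale (\<lambda>ys. lin_ext scale (\<lambda>xs. f xs ys) s) t"
  unfolding lin_ext_def scale_sum_right
  by (subst sum.swap) (simp add: mult.commute)

lemma lin_ext_cong_length:
  assumes "has_length n t" "\<And>xs. length xs = n \<Longrightarrow> f xs = g xs"
  shows "lin_ext scale f t = lin_ext scale g t"
  using assms unfolding lin_ext_def has_length_def by (intro sum.cong) auto

end

lemma has_length_zero [simp]: "has_length n 0"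
  by (simp add: has_length_def)

lemma has_length_add: "has_length n s \<Longrightarrow> has_length n t \<Longrightarrow> has_length n (s + t)"
  using Poly_Mapping.keys_add[of s t] by (auto simp: has_length_def)

lemma has_length_sum:
  "(\<And>i. i \<in> I \<Longrightarrow> has_length n (t i)) \<Longrightarrow> has_length n (\<Sum>i\<in>I. t i)"
  by (induction I rule: infinite_finite_induct) (auto intro: has_length_add)

lemma has_length_tscale: "has_length n t \<Longrightarrow> has_length n (tscale k t)"
  by (auto simp: has_length_def in_keys_iff lookup_tscale)

lemma has_length_pure [simp]: "has_length n (pure xs :: ('a, 'k::field) tensor) \<longleftrightarrow> length xs = n"
  by (auto simp: has_length_def pure_def)

lemma has_length_lin_ext:
  assumes "has_length n t" "\<And>xs. length xs = n \<Longrightarrow> has_length m (f xs)"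
  shows "has_length m (lin_ext tscale f t)"
  using assms unfolding lin_ext_def
  by (intro has_length_sum has_length_tscale) (auto simp: has_length_def)

lemma has_length_tprod:
  assumes "has_length m s" "has_length n t"
  shows "has_length (m + n) (s \<otimes>\<^sub>t t)"
  using assms unfolding tprod_def by (intro has_length_lin_ext[of m] has_length_lin_ext[of n]) auto

lemma has_length_tmap:
  fixes t :: "('a, 'k::field) tensor"
  assumes t: "has_length n t" and fs: "length fs = n" "list_all2 (\<lambda>f m. \<forall>x. has_length m (f x)) fs ms"
  shows "has_length (sum_list ms) (tmap fs t)"
  unfolding tmap_def
proof (rule has_length_lin_ext[OF t])
  fix xs :: "'a list" assume "length xs = n"
  hence "length xs = length fs" using fs by simp
  with fs(2) show "has_length (sum_list ms) (foldr (\<otimes>\<^sub>t) (map2 (\<lambda>f x. f x) fs xs) (pure []))"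
  proof (induction fs ms arbitrary: xs rule: list_all2_induct)
    case (Cons f fs m ms)
    then obtain y ys where "xs = y # ys" "length ys = length fs" by (cases xs) auto
    thus ?case using Cons by (auto intro: has_length_tprod)
  qed simp
qed

lemma (in vector_space) lin_ext_tprod:
  "lin_ext scale f (s \<otimes>\<^sub>t t) = lin_ext scale (\<lambda>xs. lin_ext scale (\<lambda>ys. f (xs @ ys)) t) s"
  by (simp add: tprod_def lin_ext_lin_ext)

section \<open>Homogeneous components\<close>

lemma bit_add_self [simp]: "d + d = (0::bit)"
  by (cases d) (auto simp: add_bit_eq_xor)

lemma length_numeral_cases:
  "length xs = 2 \<Longrightarrow> \<exists>x y. xs = [x, y]"
  "length xs = 3 \<Longrightarrow> \<exists>x y z. xs = [x, y, z]"
  "length xs = 4 \<Longrightarrow> \<exists>x y z w. xs = [x, y, z, w]"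
  by (auto simp: numeral_eq_Suc length_Suc_conv)

context superalgebra
begin

abbreviation lin :: "('a \<Rightarrow> 'a) \<Rightarrow> bool" where
  "lin \<equiv> Vector_Spaces.linear scale scale"

lemma lin_iff: "lin f \<longleftrightarrow> (\<forall>x y. f (x + y) = f x + f y) \<and> (\<forall>k x. f (k *s x) = k *s f x)"
  using vector_space_axioms by (simp add: Vector_Spaces.linear_iff)

lemma lin_0: "lin f \<Longrightarrow> f 0 = 0"
  unfolding lin_iff by (metis add_cancel_right_left)

lemma lin_ident [intro]: "lin (\<lambda>x. x)"
  by (simp add: lin_iff)

lemma lin_mult_left [intro]: "lin f \<Longrightarrow> lin (\<lambda>x. b * f x)"
  by (simp add: lin_iff scale_mult_right distrib_left)

lemma lin_mult_right [intro]: "lin f \<Longrightarrow> lin (\<lambda>x. f x * b)"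
  by (simp add: lin_iff scale_mult_left distrib_right)

lemma lin_scale [intro]: "lin f \<Longrightarrow> lin (\<lambda>x. k *s f x)"
  by (simp add: lin_iff scale_right_distrib mult.commute)

lemma lin_compose: "lin f \<Longrightarrow> lin g \<Longrightarrow> lin (\<lambda>x. f (g x))"
  by (simp add: lin_iff)

lemma lin_sum: "(\<And>i. i \<in> I \<Longrightarrow> lin (f i)) \<Longrightarrow> lin (\<lambda>x. \<Sum>i\<in>I. f i x)"
  by (simp add: lin_iff sum.distrib scale_sum_right)

lemma lin_lin_ext:
  "(\<And>ys. ys \<in> Poly_Mapping.keys t \<Longrightarrow> lin (\<lambda>x. f x ys)) \<Longrightarrow> lin (\<lambda>x. lin_ext scale (f x) t)"
  unfolding lin_ext_def by (intro lin_sum lin_scale) auto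

lemma lin_apply_lin_ext:
  fixes t :: "('a, 'k) tensor"
  assumes h: "lin h"
  shows "h (lin_ext scale f t) = lin_ext scale (\<lambda>xs. h (f xs)) t"
proof -
  have "h (\<Sum>xs\<in>X. g xs) = (\<Sum>xs\<in>X. h (g xs))" for X and g :: "'a list \<Rightarrow> 'a"
    using h lin_0[OF h] by (induction X rule: infinite_finite_induct) (auto simp: lin_iff)
  thus ?thesis using h by (simp add: lin_ext_def lin_iff)
qed

lemma lin_ext_cong_3:
  assumes "has_length 3 t" "\<And>x y z. f [x, y, z] = g [x, y, z]"
  shows "lin_ext scale f t = lin_ext scale g t"
  using assms(2) by (intro lin_ext_cong_length[OF assms(1)]) (auto dest!: length_numeral_cases(2))

lemma lin_ext_cong_2:
  assumes "has_length 2 t" "\<And>x y. f [x, y] = g [x, y]"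
  shows "lin_ext scale f t = lin_ext scale g t"
  using assms(2) by (intro lin_ext_cong_length[OF assms(1)]) (auto dest!: length_numeral_cases(1))

lemma gr_closed:
  "x \<in> gr i \<Longrightarrow> y \<in> gr i \<Longrightarrow> x + y \<in> gr i"
  "x \<in> gr i \<Longrightarrow> y \<in> gr i \<Longrightarrow> x - y \<in> gr i"
  "x \<in> gr i \<Longrightarrow> k *s x \<in> gr i"
  "0 \<in> gr i"
  using subspace_gr by (auto intro: subspace_add subspace_diff subspace_scale subspace_0)

lemma hcomp_unique: "\<exists>!x. x \<in> gr i \<and> a - x \<in> gr (i + 1)"
proof -
  obtain x y where xy: "x \<in> gr 0" "y \<in> gr 1" "a = x + y"
    using gr_decomp by blast
  have ex: "\<exists>x. x \<in> gr i \<and> a - x \<in> gr (i + 1)"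
  proof (cases i)
    assume "i = 0"
    with xy show ?thesis by (intro exI[of _ x]) simp
  next
    assume "i = 1"
    with xy show ?thesis by (intro exI[of _ y]) simp
  qed
  have "u = v" if "u \<in> gr i" "a - u \<in> gr (i + 1)" "v \<in> gr i" "a - v \<in> gr (i + 1)" for u v
  proof -
    have "u - v \<in> gr i" by (rule gr_closed(2)[OF that(1,3)])
    moreover have "(a - v) - (a - u) \<in> gr (i + 1)" by (rule gr_closed(2)[OF that(4,2)])
    hence "u - v \<in> gr (i + 1)" by simp
    ultimately have "u - v \<in> gr 0 \<inter> gr 1" by (cases i) auto
    thus ?thesis using gr_Int by simp
  qed
  with ex show ?thesis by blast
qed

lemma hcomp_eqI: "x \<in> gr i \<Longrightarrow> a - x \<in> gr (i + 1) \<Longrightarrow> hcomp i a = x"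
  unfolding hcomp_def using hcomp_unique by blast

lemma hcomp_gr: "hcomp i a \<in> gr i" and hcomp_diff: "a - hcomp i a \<in> gr (i + 1)"
  using theI'[OF hcomp_unique[of i a]] unfolding hcomp_def by auto

lemma hcomp_homogeneous: "x \<in> gr d \<Longrightarrow> hcomp i x = (if i = d then x else 0)"
  by (rule hcomp_eqI; cases i; cases d) (auto intro: gr_closed)

lemma hcomp_add: "hcomp 0 a + hcomp 1 a = a"
proof -
  have "hcomp 1 a = a - hcomp 0 a"
    using hcomp_gr[of 0 a] hcomp_diff[of a 0] by (intro hcomp_eqI) auto
  thus ?thesis by simp
qed

lemma lin_hcomp [intro]: "lin f \<Longrightarrow> lin (\<lambda>x. hcomp i (f x))"
proof (rule lin_compose[of "hcomp i"])
  have "hcomp i (a + b) = hcomp i a + hcomp i b" for a b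
  proof (rule hcomp_eqI)
    have "(a - hcomp i a) + (b - hcomp i b) \<in> gr (i + 1)"
      by (intro gr_closed hcomp_diff)
    thus "a + b - (hcomp i a + hcomp i b) \<in> gr (i + 1)"
      by (simp add: algebra_simps)
  qed (intro gr_closed hcomp_gr)
  moreover have "hcomp i (k *s a) = k *s hcomp i a" for k a
  proof (rule hcomp_eqI)
    show "k *s a - k *s hcomp i a \<in> gr (i + 1)"
      unfolding scale_right_diff_distrib[symmetric] by (intro gr_closed hcomp_diff)
  qed (intro gr_closed hcomp_gr)
  ultimately show "lin (hcomp i)" by (simp add: lin_iff)
qed

lemma lin_eq_homogeneousI:
  assumes "lin f" "lin g" "\<And>d x. x \<in> gr d \<Longrightarrow> f x = g x"
  shows "f a = g a"
proof -
  have "f (hcomp 0 a + hcomp 1 a) = g (hcomp 0 a + hcomp 1 a)"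
    using assms hcomp_gr[of 0 a] hcomp_gr[of 1 a] unfolding lin_iff by metis
  thus ?thesis by (simp only: hcomp_add)
qed

section \<open>Multilinear functions of lists\<close>

definition multilinear :: "nat \<Rightarrow> ('a list \<Rightarrow> 'a) \<Rightarrow> bool" where
  "multilinear n f \<longleftrightarrow> (\<forall>xs i. length xs = n \<longrightarrow> i < n \<longrightarrow> lin (\<lambda>a. f (xs[i := a])))"

abbreviation homogeneous_list :: "'a list \<Rightarrow> bit list \<Rightarrow> bool" where
  "homogeneous_list \<equiv> list_all2 (\<lambda>x d. x \<in> gr d)"

text \<open>
  An element is the sum of its two homogeneous components, so by linearity the entries of a list can
  be made homogeneous one after the other.
\<close>

lemma multilinear_eq_homogeneousI:
  assumes f: "multilinear n f" and g: "multilinear n g"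
    and eq: "\<And>xs ds. length xs = n \<Longrightarrow> homogeneous_list xs ds \<Longrightarrow> f xs = g xs"
    and len: "length xs = n"
  shows "f xs = g xs"
proof -
  \<comment> \<open>The induction is on the number of leading entries that need not be homogeneous.\<close>
  have "\<forall>xs. length xs = n \<longrightarrow> (\<forall>i<n. i \<ge> k \<longrightarrow> (\<exists>d. xs ! i \<in> gr d)) \<longrightarrow> f xs = g xs"
    if "k \<le> n" for k using that
  proof (induction k)
    case 0
    show ?case
    proof (intro allI impI)
      fix xs :: "'a list" assume len: "length xs = n" and "\<forall>i<n. 0 \<le> i \<longrightarrow> (\<exists>d. xs ! i \<in> gr d)"
      hence "\<forall>i. \<exists>d. i < n \<longrightarrow> xs ! i \<in> gr d" by blast
      then obtain d where "\<forall>i<n. xs ! i \<in> gr (d i)" by metis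
      hence "homogeneous_list xs (map d [0..<n])"
        using len by (auto simp: list_all2_conv_all_nth)
      with len show "f xs = g xs" by (rule eq)
    qed
  next
    case (Suc k)
    show ?case
    proof (intro allI impI)
      fix xs :: "'a list"
      assume len: "length xs = n" and h: "\<forall>i<n. Suc k \<le> i \<longrightarrow> (\<exists>d. xs ! i \<in> gr d)"
      have k: "k < n" using Suc.prems by simp
      have "f (xs[k := xs ! k]) = g (xs[k := xs ! k])"
      proof (rule lin_eq_homogeneousI[where f = "\<lambda>a. f (xs[k := a])" and g = "\<lambda>a. g (xs[k := a])"])
        show "lin (\<lambda>a. f (xs[k := a]))" "lin (\<lambda>a. g (xs[k := a]))"
          using f g len k by (auto simp: multilinear_def)
        show "f (xs[k := x]) = g (xs[k := x])" if "x \<in> gr d" for d x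
        proof -
          have "\<exists>d. xs[k := x] ! i \<in> gr d" if "i < n" "k \<le> i" for i
            using h that \<open>x \<in> gr d\<close> len by (cases "i = k") auto
          thus ?thesis using Suc.IH Suc.prems len by simp
        qed
      qed
      thus "f xs = g xs" by simp
    qed
  qed
  from this[OF le_refl] len show ?thesis by simp
qed

lemma multilinear2I:
  assumes "\<And>y. lin (\<lambda>x. f [x, y])" "\<And>x. lin (\<lambda>y. f [x, y])"
  shows "multilinear 2 f"
  unfolding multilinear_def
proof (intro allI impI)
  fix xs :: "'a list" and i :: nat assume "length xs = 2" "i < 2"
  thus "lin (\<lambda>a. f (xs[i := a]))"
    using assms length_numeral_cases(1)[of xs] by (auto simp: numeral_eq_Suc less_Suc_eq)
qed

lemma multilinear3I:
  assumes "\<And>y z. lin (\<lambda>x. f [x, y, z])" "\<And>x z. lin (\<lambda>y. f [x, y, z])" "\<And>x y. lin (\<lambda>z. f [x, y, z])"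
  shows "multilinear 3 f"
  unfolding multilinear_def
proof (intro allI impI)
  fix xs :: "'a list" and i :: nat assume "length xs = 3" "i < 3"
  thus "lin (\<lambda>a. f (xs[i := a]))"
    using assms length_numeral_cases(2)[of xs] by (auto simp: numeral_eq_Suc less_Suc_eq)
qed

lemma multilinear4I:
  assumes "\<And>y z w. lin (\<lambda>x. f [x, y, z, w])" "\<And>x z w. lin (\<lambda>y. f [x, y, z, w])"
    "\<And>x y w. lin (\<lambda>z. f [x, y, z, w])" "\<And>x y z. lin (\<lambda>w. f [x, y, z, w])"
  shows "multilinear 4 f"
  unfolding multilinear_def
proof (intro allI impI)
  fix xs :: "'a list" and i :: nat assume "length xs = 4" "i < 4"
  thus "lin (\<lambda>a. f (xs[i := a]))"
    using assms length_numeral_cases(3)[of xs] by (auto simp: numeral_eq_Suc less_Suc_eq)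
qed

lemma multilinear1_iff: "multilinear (Suc 0) f \<longleftrightarrow> lin (\<lambda>x. f [x])"
  by (auto simp: multilinear_def length_Suc_conv)

lemma multilinear_cong:
  assumes "multilinear n g" "\<And>xs. length xs = n \<Longrightarrow> f xs = g xs"
  shows "multilinear n f"
  using assms unfolding multilinear_def by simp

lemma multilinear_append_arg:
  assumes "multilinear n f" "length us + k + length vs = n"
  shows "multilinear k (\<lambda>xs. f (us @ xs @ vs))"
  unfolding multilinear_def
proof (intro allI impI)
  fix xs :: "'a list" and i assume *: "length xs = k" "i < k"
  have "(\<lambda>a. f (us @ xs[i := a] @ vs)) = (\<lambda>a. f ((us @ xs @ vs)[length us + i := a]))"
    using * by (simp add: list_update_append)
  thus "lin (\<lambda>a. f (us @ xs[i := a] @ vs))"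
    using assms * by (simp add: multilinear_def)
qed

lemma multilinear_lin: "multilinear n f \<Longrightarrow> length us + 1 + length vs = n \<Longrightarrow> lin (\<lambda>a. f (us @ a # vs))"
  using multilinear_append_arg[of n f us 1 vs]
  unfolding multilinear_def by (auto dest!: spec[of _ "[0]"])

lemma multilinear_lin3:
  assumes "multilinear 3 f"
  shows "lin (\<lambda>x. f [x, y, z])" "lin (\<lambda>y. f [x, y, z])" "lin (\<lambda>z. f [x, y, z])"
  using multilinear_lin[OF assms, of "[]" "[y, z]"] multilinear_lin[OF assms, of "[x]" "[z]"]
    multilinear_lin[OF assms, of "[x, y]" "[]"] by simp_all

lemma multilinear_lin2:
  assumes "multilinear 2 f"
  shows "lin (\<lambda>x. f [x, y])" "lin (\<lambda>y. f [x, y])"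
  using multilinear_lin[OF assms, of "[]" "[y]"] multilinear_lin[OF assms, of "[x]" "[]"] by simp_all

lemma multilinear_map:
  assumes f: "multilinear n f" and g: "\<And>i. i < n \<Longrightarrow> lin (g i)"
  shows "multilinear n (\<lambda>xs. f (map (\<lambda>i. g i (xs ! i)) [0..<n]))"
  unfolding multilinear_def
proof (intro allI impI)
  fix xs :: "'a list" and i assume *: "length xs = n" "i < n"
  let ?ys = "map (\<lambda>i. g i (xs ! i)) [0..<n]"
  have "map (\<lambda>j. g j (xs[i := a] ! j)) [0..<n] = ?ys[i := g i a]" for a
    using * by (intro nth_equalityI) (auto simp: nth_list_update)
  moreover have "lin (\<lambda>a. f (?ys[i := a]))"
    using f * by (auto simp: multilinear_def)
  ultimately show "lin (\<lambda>a. f (map (\<lambda>j. g j (xs[i := a] ! j)) [0..<n]))"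
    using g[OF *(2)] by (simp add: lin_compose[of "\<lambda>a. f (?ys[i := a])"])
qed

lemma multilinear_sum:
  "(\<And>i. i \<in> I \<Longrightarrow> multilinear n (f i)) \<Longrightarrow> multilinear n (\<lambda>xs. \<Sum>i\<in>I. f i xs)"
  unfolding multilinear_def by (auto intro!: lin_sum)

lemma multilinear_scale: "multilinear n f \<Longrightarrow> multilinear n (\<lambda>xs. k *s f xs)"
  unfolding multilinear_def by (auto intro!: lin_scale)

lemma multilinear_lin_ext:
  "has_length m t \<Longrightarrow> (\<And>ys. length ys = m \<Longrightarrow> multilinear n (\<lambda>xs. f xs ys)) \<Longrightarrow>
     multilinear n (\<lambda>xs. lin_ext scale (f xs) t)"
  unfolding multilinear_def has_length_def by (auto intro!: lin_lin_ext)

lemma multilinear_compose: "lin h \<Longrightarrow> multilinear n f \<Longrightarrow> multilinear n (\<lambda>xs. h (f xs))"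
  unfolding multilinear_def by (auto intro: lin_compose[of h])

section \<open>Tensors up to multilinear functions\<close>

definition mequiv :: "nat \<Rightarrow> ('a, 'k) tensor \<Rightarrow> ('a, 'k) tensor \<Rightarrow> bool" where
  "mequiv n s t \<longleftrightarrow> (\<forall>f. multilinear n f \<longrightarrow> lin_ext scale f s = lin_ext scale f t)"

text \<open>
  The relations defining \<open>\<approx>\<close> are imposed in all lengths at once, so a function that is
  multilinear on lists of length \<open>n\<close> is cut off to zero on the other lists. The cut-off function
  vanishes on every relation, because a relation involves lists of a single length.
\<close>

lemma lin_ext_teq:
  assumes "multilinear n f" "s \<approx> t"
  shows "lin_ext scale (\<lambda>xs. if length xs = n then f xs else 0) s
       = lin_ext scale (\<lambda>xs. if length xs = n then f xs else 0) t" (is "lin_ext _ ?f _ = _")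
proof -
  let ?T = "{u. lin_ext scale ?f u = 0}"
  have "tensor.subspace ?T"
    by (auto simp: tensor.subspace_def lin_ext_add lin_ext_tscale)
  moreover have "multilinear_relations \<subseteq> ?T"
  proof -
    have "lin (\<lambda>a. ?f (xs @ a # ys))" for xs ys
      using multilinear_lin[OF assms(1), of xs ys]
      by (cases "length xs + 1 + length ys = n") (auto simp: lin_iff)
    hence "?f (xs @ (a + b) # ys) = ?f (xs @ a # ys) + ?f (xs @ b # ys)"
      "?f (xs @ (k *s a) # ys) = k *s ?f (xs @ a # ys)" for xs ys a b k
      unfolding lin_iff by blast+
    thus ?thesis unfolding multilinear_relations_def
      by (auto simp only: lin_ext_diff lin_ext_tscale lin_ext_pure Un_iff mem_Collect_eq)
        (simp_all only: diff_self add_diff_cancel_left')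
  qed
  ultimately have "s - t \<in> ?T"
    using assms(2) tensor.span_minimal[of multilinear_relations ?T] by (auto simp: teq_def)
  thus ?thesis by (simp add: lin_ext_diff)
qed

lemma mequiv_teq:
  assumes "has_length n s" "has_length n t" "s \<approx> t"
  shows "mequiv n s t"
  unfolding mequiv_def
proof (intro allI impI)
  fix f assume "multilinear n f"
  from lin_ext_teq[OF this assms(3)] show "lin_ext scale f s = lin_ext scale f t"
    using lin_ext_cong_length[OF assms(1), of f "\<lambda>xs. if length xs = n then f xs else 0"]
      lin_ext_cong_length[OF assms(2), of f "\<lambda>xs. if length xs = n then f xs else 0"] by simp
qed

lemma mequiv_sym: "mequiv n s t \<Longrightarrow> mequiv n t s"
  by (simp add: mequiv_def)

lemma mequiv_trans [trans]: "mequiv n s t \<Longrightarrow> mequiv n t u \<Longrightarrow> mequiv n s u"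
  by (simp add: mequiv_def)

end

lemma mult_sign_3:
  "mult_sign [a, b, c] [x, y, z] = ksign b x * ksign c x * ksign c y"
  by (simp add: mult_sign_def numeral_eq_Suc lessThan_Suc mult_ac)

lemma mult_sign_4:
  "mult_sign [a, b, c, d] [x, y, z, w]
     = ksign b x * ksign c x * ksign c y * ksign d x * ksign d y * ksign d z"
  by (simp add: mult_sign_def numeral_eq_Suc lessThan_Suc mult_ac)

lemma ksign_0 [simp]: "ksign 0 d = 1" "ksign d 0 = 1"
  by (simp_all add: ksign_def)

lemma ksign_add:
  "ksign (a + b) c = ksign a c * ksign b c" "ksign a (b + c) = ksign a b * ksign a c"
  by (cases a; cases b; cases c; simp add: ksign_def)+

context superalgebra
begin

section \<open>Multiplication of tensors\<close>

text \<open>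
  The value of \<open>f\<close> at the graded product of the pure tensors \<open>xs\<close> and \<open>ys\<close>. All computations
  with products are computations with this function, which is multilinear in both lists.
\<close>

definition mval :: "('a list \<Rightarrow> 'a) \<Rightarrow> 'a list \<Rightarrow> 'a list \<Rightarrow> 'a" where
  "mval f xs ys = lin_ext scale f (pure_mult xs ys)"

lemma mult_sign_add_left:
  assumes "length ds = length es"
  shows "mult_sign (map2 (+) ds es) fs = mult_sign ds fs * mult_sign es fs"
  using assms by (simp add: mult_sign_def ksign_add prod.distrib)

lemma mult_sign_add_right:
  assumes "length ds = length es" "length es = length fs"
  shows "mult_sign ds (map2 (+) es fs) = mult_sign ds es * mult_sign ds fs"
  using assms by (simp add: mult_sign_def ksign_add prod.distrib)

lemma mval_expand:
  assumes "length xs = n" "length ys = n"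
  shows "mval f xs ys = (\<Sum>ds | length ds = n. \<Sum>es | length es = n. mult_sign ds es *s
           f (map (\<lambda>i. hcomp (ds ! i) (xs ! i) * hcomp (es ! i) (ys ! i)) [0..<n]))"
proof -
  have set: "set (List.n_lists n [0, 1]) = {ds :: bit list. length ds = n}"
    by (auto simp: set_n_lists)
  have "map2 (*) (map2 hcomp ds xs) (map2 hcomp es ys)
      = map (\<lambda>i. hcomp (ds ! i) (xs ! i) * hcomp (es ! i) (ys ! i)) [0..<n]"
    if "length ds = n" "length es = n" for ds es
    using that assms by (intro nth_equalityI) auto
  thus ?thesis
    using assms unfolding mval_def pure_mult_def
    by (simp add: set lin_ext_sum lin_ext_tscale)
qed

lemma multilinear_mval_left:
  assumes f: "multilinear n f" and len: "length ys = n"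
  shows "multilinear n (\<lambda>xs. mval f xs ys)"
proof (rule multilinear_cong[OF _ mval_expand[OF _ len]])
  show "multilinear n (\<lambda>xs. \<Sum>ds | length ds = n. \<Sum>es | length es = n. mult_sign ds es *s
           f (map (\<lambda>i. hcomp (ds ! i) (xs ! i) * hcomp (es ! i) (ys ! i)) [0..<n]))"
    by (intro multilinear_sum multilinear_scale
        multilinear_map[OF f, where g = "\<lambda>i x. hcomp (_ ! i) x * hcomp (_ ! i) (ys ! i)"] lin_mult_right lin_hcomp lin_ident)
qed

lemma multilinear_mval_right:
  assumes f: "multilinear n f" and len: "length xs = n"
  shows "multilinear n (\<lambda>ys. mval f xs ys)"
proof (rule multilinear_cong[OF _ mval_expand[OF len]])
  show "multilinear n (\<lambda>ys. \<Sum>ds | length ds = n. \<Sum>es | length es = n. mult_sign ds es *s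
           f (map (\<lambda>i. hcomp (ds ! i) (xs ! i) * hcomp (es ! i) (ys ! i)) [0..<n]))"
    by (intro multilinear_sum multilinear_scale
        multilinear_map[OF f, where g = "\<lambda>i y. hcomp (_ ! i) (xs ! i) * hcomp (_ ! i) y"] lin_mult_left lin_hcomp lin_ident)
qed

lemma multilinear_zero_arg:
  assumes "multilinear n f" "length xs = n" "i < n" "xs ! i = 0"
  shows "f xs = 0"
proof -
  have "lin (\<lambda>a. f (xs[i := a]))" using assms by (simp add: multilinear_def)
  from lin_0[OF this] assms(4) show ?thesis by (metis list_update_id)
qed

lemma finite_bit_lists: "finite {ds :: bit list. length ds = n}"
proof -
  have "(UNIV :: bit set) = {0, 1}" by auto
  hence "finite (UNIV :: bit set)" by (metis finite.emptyI finite.insertI)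
  from finite_lists_length_eq[OF this, of n] show ?thesis by simp
qed

text \<open>
  Decomposing a homogeneous element into components leaves only the element itself, so a single
  pair of degree lists contributes to the sum defining the product.
\<close>

lemma mval_homogeneous:
  assumes f: "multilinear n f" and len: "length xs = n" "length ys = n"
    and hom: "homogeneous_list xs ds" "homogeneous_list ys es"
  shows "mval f xs ys = mult_sign ds es *s f (map2 (*) xs ys)"
proof -
  let ?f = "\<lambda>ds' es'. mult_sign ds' es' *s
    f (map (\<lambda>i. hcomp (ds' ! i) (xs ! i) * hcomp (es' ! i) (ys ! i)) [0..<n])"
  let ?N = "{ds :: bit list. length ds = n}"
  have comp: "hcomp (ds' ! i) (xs ! i) = (if ds' ! i = ds ! i then xs ! i else 0)"
    "hcomp (es' ! i) (ys ! i) = (if es' ! i = es ! i then ys ! i else 0)" if "i < n" for ds' es' i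
    using hom len that by (auto simp: list_all2_conv_all_nth hcomp_homogeneous[of _ "_ ! i"])
  have mem: "ds \<in> ?N" "es \<in> ?N"
    using hom len by (auto dest: list_all2_lengthD)
  have zero: "?f ds' es' = 0" if "ds' \<in> ?N" "es' \<in> ?N" "ds' \<noteq> ds \<or> es' \<noteq> es" for ds' es'
  proof -
    have "\<exists>i<n. ds' ! i \<noteq> ds ! i \<or> es' ! i \<noteq> es ! i"
      using that mem by (auto simp: list_eq_iff_nth_eq)
    then obtain i where "i < n" "ds' ! i \<noteq> ds ! i \<or> es' ! i \<noteq> es ! i"
      by blast
    thus ?thesis
      by (subst multilinear_zero_arg[OF f, of _ i]) (auto simp: comp)
  qed
  have "mval f xs ys = (\<Sum>ds'\<in>?N. \<Sum>es'\<in>?N. ?f ds' es')"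
    by (rule mval_expand[OF len])
  also have "\<dots> = (\<Sum>es'\<in>?N. ?f ds es')"
    using finite_bit_lists mem zero
    by (subst sum.mono_neutral_right[where S = "{ds}"]) (auto intro!: sum.neutral)
  also have "\<dots> = ?f ds es"
    using finite_bit_lists mem zero
    by (subst sum.mono_neutral_right[where S = "{es}"]) auto
  also have "map (\<lambda>i. hcomp (ds ! i) (xs ! i) * hcomp (es ! i) (ys ! i)) [0..<n] = map2 (*) xs ys"
    using len by (intro nth_equalityI) (auto simp: comp)
  finally show ?thesis .
qed

lemma homogeneous_list_mult:
  "homogeneous_list xs ds \<Longrightarrow> homogeneous_list ys es \<Longrightarrow>
     homogeneous_list (map2 (*) xs ys) (map2 (+) ds es)"
  by (auto simp: list_all2_conv_all_nth intro: mult_gr)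

lemma lin_ext_tmult:
  "lin_ext scale f (s \<bullet> t) = lin_ext scale (\<lambda>xs. lin_ext scale (\<lambda>ys. mval f xs ys) t) s"
  by (simp add: tmult_def lin_ext_lin_ext mval_def)

lemma has_length_pure_mult:
  assumes "length xs = n" "length ys = n"
  shows "has_length n (pure_mult xs ys)"
  using assms unfolding pure_mult_def
  by (intro has_length_sum has_length_tscale) (auto simp: length_n_lists_elem)

lemma mval_cong:
  assumes "length xs = n" "length ys = n" "\<And>ts. length ts = n \<Longrightarrow> f ts = g ts"
  shows "mval f xs ys = mval g xs ys"
  unfolding mval_def by (rule lin_ext_cong_length[OF has_length_pure_mult[OF assms(1,2)] assms(3)])

lemma multilinear_mval_fun:
  assumes "\<And>us. length us = n \<Longrightarrow> multilinear m (\<lambda>zs. f zs us)" "length xs = n" "length ys = n"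
  shows "multilinear m (\<lambda>zs. mval (f zs) xs ys)"
  unfolding mval_def
  by (rule multilinear_lin_ext[OF has_length_pure_mult[OF assms(2,3)]]) (rule assms(1))

lemma multilinear_eq_homogeneousI2:
  assumes "\<And>ys. length ys = n \<Longrightarrow> multilinear m (\<lambda>xs. F xs ys)"
    "\<And>ys. length ys = n \<Longrightarrow> multilinear m (\<lambda>xs. G xs ys)"
    "\<And>xs. length xs = m \<Longrightarrow> multilinear n (F xs)"
    "\<And>xs. length xs = m \<Longrightarrow> multilinear n (G xs)"
    and eq: "\<And>xs ys ds es. length xs = m \<Longrightarrow> length ys = n \<Longrightarrow>
      homogeneous_list xs ds \<Longrightarrow> homogeneous_list ys es \<Longrightarrow> F xs ys = G xs ys"
    and len: "length xs = m" "length ys = n"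
  shows "F xs ys = G xs ys"
proof (rule multilinear_eq_homogeneousI[OF assms(1,2)[OF len(2)] _ len(1)])
  fix xs ds assume xs: "length xs = m" "homogeneous_list xs ds"
  show "F xs ys = G xs ys"
    by (rule multilinear_eq_homogeneousI[OF assms(3,4)[OF xs(1)] _ len(2)]) (rule eq[OF xs(1) _ xs(2)])
qed

text \<open>
  On homogeneous lists both sides carry a product of Koszul signs. The two products agree because
  the sign is biadditive in the degrees.
\<close>

lemma mval_assoc:
  assumes f: "multilinear n f" and len: "length xs = n" "length ys = n" "length zs = n"
  shows "mval (\<lambda>us. mval f us zs) xs ys = mval (\<lambda>us. mval f xs us) ys zs"
proof (rule multilinear_eq_homogeneousI[OF _ _ _ len(3)])
  note ml = multilinear_mval_left multilinear_mval_right
  show "multilinear n (\<lambda>zs. mval (\<lambda>us. mval f us zs) xs ys)"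
    by (rule multilinear_mval_fun[OF multilinear_mval_right[OF f] len(1,2)])
  show "multilinear n (\<lambda>zs. mval (\<lambda>us. mval f xs us) ys zs)"
    by (intro ml f len)
  fix zs fs assume zs: "length zs = n" "homogeneous_list zs fs"
  show "mval (\<lambda>us. mval f us zs) xs ys = mval (\<lambda>us. mval f xs us) ys zs"
  proof (rule multilinear_eq_homogeneousI2[OF _ _ _ _ _ len(1,2)])
    fix xs ys ds es
    assume xs: "length xs = n" "homogeneous_list xs ds" and ys: "length ys = n" "homogeneous_list ys es"
    have lens: "length ds = n" "length es = n" "length fs = n"
      using xs ys zs by (auto dest: list_all2_lengthD)
    have "mval (\<lambda>us. mval f us zs) xs ys = mult_sign ds es *s mval f (map2 (*) xs ys) zs"
      by (intro mval_homogeneous[where n = n] ml f xs ys zs)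
    also have "mval f (map2 (*) xs ys) zs
        = mult_sign (map2 (+) ds es) fs *s f (map2 (*) (map2 (*) xs ys) zs)"
      by (intro mval_homogeneous[where n = n] homogeneous_list_mult f xs ys zs) (simp add: xs ys)
    also have "map2 (*) (map2 (*) xs ys) zs = map2 (*) xs (map2 (*) ys zs)"
      using xs ys zs by (intro nth_equalityI) (auto simp: mult.assoc)
    also have "mult_sign ds es *s mult_sign (map2 (+) ds es) fs *s f (map2 (*) xs (map2 (*) ys zs))
        = mult_sign es fs *s mult_sign ds (map2 (+) es fs) *s f (map2 (*) xs (map2 (*) ys zs))"
      using lens by (simp add: mult_sign_add_left mult_sign_add_right mult_ac)
    also have "mult_sign ds (map2 (+) es fs) *s f (map2 (*) xs (map2 (*) ys zs))
        = mval f xs (map2 (*) ys zs)"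
      by (intro mval_homogeneous[where n = n, symmetric] homogeneous_list_mult f xs ys zs) (simp add: zs ys)
    also have "mult_sign es fs *s \<dots> = mval (\<lambda>us. mval f xs us) ys zs"
      by (intro mval_homogeneous[where n = n, symmetric] ml f xs ys zs)
    finally show "mval (\<lambda>us. mval f us zs) xs ys = mval (\<lambda>us. mval f xs us) ys zs" .
  next
    fix ys :: "'a list" assume ys: "length ys = n"
    show "multilinear n (\<lambda>xs. mval (\<lambda>us. mval f us zs) xs ys)"
      by (intro ml f zs ys)
    show "multilinear n (\<lambda>xs. mval (\<lambda>us. mval f xs us) ys zs)"
      by (rule multilinear_mval_fun[OF multilinear_mval_left[OF f] ys zs(1)])
    show "multilinear n (mval (\<lambda>us. mval f us zs) ys)"
      "multilinear n (\<lambda>xs. mval (\<lambda>us. mval f ys us) xs zs)"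
      by (intro ml f zs ys)+
  qed
qed

lemma multilinear_lin_ext_mval:
  assumes "has_length n t" "multilinear n f"
  shows "multilinear n (\<lambda>xs. lin_ext scale (mval f xs) t)" "multilinear n (\<lambda>ys. lin_ext scale (\<lambda>xs. mval f xs ys) t)"
  using assms by (auto intro: multilinear_lin_ext multilinear_mval_left multilinear_mval_right)

lemma has_length_tmult:
  assumes "has_length n s" "has_length n t"
  shows "has_length n (s \<bullet> t)"
  using assms unfolding tmult_def by (intro has_length_lin_ext[of n] has_length_pure_mult) auto

lemma mequiv_tmult:
  assumes "has_length n s" "has_length n t'" "mequiv n s s'" "mequiv n t t'"
  shows "mequiv n (s \<bullet> t) (s' \<bullet> t')"
  unfolding mequiv_def
proof (intro allI impI)
  fix f assume f: "multilinear n f"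
  have "lin_ext scale f (s \<bullet> t) = lin_ext scale (\<lambda>xs. lin_ext scale (mval f xs) t') s"
    unfolding lin_ext_tmult using assms(4) f
    by (intro lin_ext_cong_length[OF assms(1)]) (auto simp: mequiv_def intro: multilinear_mval_right)
  also have "\<dots> = lin_ext scale (\<lambda>xs. lin_ext scale (mval f xs) t') s'"
  proof -
    have "multilinear n (\<lambda>xs. lin_ext scale (mval f xs) t')"
      using multilinear_lin_ext[OF assms(2)] multilinear_mval_left[OF f] by blast
    thus ?thesis using assms(3) by (simp add: mequiv_def)
  qed
  finally show "lin_ext scale f (s \<bullet> t) = lin_ext scale f (s' \<bullet> t')"
    by (simp add: lin_ext_tmult)
qed

lemma mequiv_tmult_assoc:
  assumes "has_length n s" "has_length n t" "has_length n u"
  shows "mequiv n (s \<bullet> t \<bullet> u) (s \<bullet> (t \<bullet> u))"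
  unfolding mequiv_def
proof (intro allI impI)
  fix f assume f: "multilinear n f"
  have "lin_ext scale f (s \<bullet> t \<bullet> u) = lin_ext scale (\<lambda>xs. lin_ext scale (\<lambda>ys.
      lin_ext scale (\<lambda>zs. mval (\<lambda>us. mval f us zs) xs ys) u) t) s"
    unfolding lin_ext_tmult mval_def by (subst lin_ext_swap) (rule refl)
  also have "\<dots> = lin_ext scale (\<lambda>xs. lin_ext scale (\<lambda>ys.
      lin_ext scale (\<lambda>zs. mval (\<lambda>us. mval f xs us) ys zs) u) t) s"
    by (intro lin_ext_cong_length[OF assms(1)] lin_ext_cong_length[OF assms(2)]
        lin_ext_cong_length[OF assms(3)] mval_assoc[OF f])
  finally show "lin_ext scale f (s \<bullet> t \<bullet> u) = lin_ext scale f (s \<bullet> (t \<bullet> u))"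
    by (simp add: lin_ext_tmult)
qed

lemma mult_sign_one:
  assumes "length ds = n"
  shows "mult_sign ds (replicate n 0) = 1" "mult_sign (replicate n 0) ds = 1"
  using assms by (auto simp: mult_sign_def ksign_def intro!: prod.neutral)

lemma homogeneous_list_one: "homogeneous_list (replicate n 1) (replicate n 0)"
  by (simp add: list_all2_conv_all_nth one_gr)

lemma mval_one:
  assumes f: "multilinear n f" and len: "length xs = n"
  shows "mval f xs (replicate n 1) = f xs" "mval f (replicate n 1) xs = f xs"
proof -
  have hom: "mval f xs (replicate n 1) = f xs" "mval f (replicate n 1) xs = f xs"
    if "length xs = n" "homogeneous_list xs ds" for xs ds
  proof -
    have "map2 (*) xs (replicate n 1) = xs" "map2 (*) (replicate n 1) xs = xs"
      using that by (auto intro!: nth_equalityI)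
    thus "mval f xs (replicate n 1) = f xs" "mval f (replicate n 1) xs = f xs"
      using that list_all2_lengthD[OF that(2)]
        mval_homogeneous[OF f _ _ that(2) homogeneous_list_one[of n]]
        mval_homogeneous[OF f _ _ homogeneous_list_one[of n] that(2)]
      by (simp_all add: mult_sign_one)
  qed
  show "mval f xs (replicate n 1) = f xs" "mval f (replicate n 1) xs = f xs"
    by (rule multilinear_eq_homogeneousI[OF _ f _ len],
        (rule multilinear_mval_left[OF f] multilinear_mval_right[OF f]; simp), erule (1) hom)+
qed

lemma mval_one_3: "multilinear 3 f \<Longrightarrow> length xs = 3 \<Longrightarrow> mval f xs [1, 1, 1] = f xs \<and> mval f [1, 1, 1] xs = f xs"
  using mval_one[of 3 f xs] by (simp add: numeral_eq_Suc)

lemma mval_one_4: "multilinear 4 f \<Longrightarrow> length xs = 4 \<Longrightarrow> mval f xs [1, 1, 1, 1] = f xs \<and> mval f [1, 1, 1, 1] xs = f xs"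
  using mval_one[of 4 f xs] by (simp add: numeral_eq_Suc)

lemma mequiv_tmult_one:
  assumes "has_length n t"
  shows "mequiv n (t \<bullet> pure (replicate n 1)) t" "mequiv n (pure (replicate n 1) \<bullet> t) t"
  unfolding mequiv_def lin_ext_tmult
  by (auto intro!: lin_ext_cong_length[OF assms] simp: mval_one)

text \<open>
  The unit is even, so a unit in the last slot of both factors does not affect the signs.
\<close>

lemma mval_append_one:
  assumes f: "multilinear (Suc n) f" and len: "length xs = n" "length ys = n"
  shows "mval f (xs @ [1]) (ys @ [1]) = mval (\<lambda>us. f (us @ [1])) xs ys"
proof (rule multilinear_eq_homogeneousI2[OF _ _ _ _ _ len])
  have f': "multilinear n (\<lambda>us. f (us @ [1]))"
    using multilinear_append_arg[OF f, of "[]" n "[1]"] by simp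
  show "multilinear n (\<lambda>xs. mval (\<lambda>us. f (us @ [1])) xs ys)"
    "multilinear n (\<lambda>xs. mval f (xs @ [1]) (ys @ [1]))" if "length ys = n" for ys
    using that f' multilinear_append_arg[OF multilinear_mval_left[OF f], of "ys @ [1]" "[]" n "[1]"]
    by (auto intro: multilinear_mval_left)
  show "multilinear n (\<lambda>ys. mval (\<lambda>us. f (us @ [1])) xs ys)"
    "multilinear n (\<lambda>ys. mval f (xs @ [1]) (ys @ [1]))" if "length xs = n" for xs
    using that f' multilinear_append_arg[OF multilinear_mval_right[OF f], of "xs @ [1]" "[]" n "[1]"]
    by (auto intro: multilinear_mval_right)
  fix xs ys ds es
  assume xs: "length xs = n" "homogeneous_list xs ds" and ys: "length ys = n" "homogeneous_list ys es"
  have lens: "length ds = n" "length es = n"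
    using xs ys by (auto dest: list_all2_lengthD)
  have "mval f (xs @ [1]) (ys @ [1]) = mult_sign (ds @ [0]) (es @ [0]) *s f (map2 (*) xs ys @ [1])"
    using xs ys by (subst mval_homogeneous[OF f]) (auto intro!: list_all2_appendI one_gr)
  also have "mult_sign (ds @ [0]) (es @ [0]) = (mult_sign ds es :: 'k)"
    using lens by (simp add: mult_sign_def ksign_def nth_append)
  also have "\<dots> *s f (map2 (*) xs ys @ [1]) = mval (\<lambda>us. f (us @ [1])) xs ys"
    by (rule mval_homogeneous[OF f', symmetric]) (use xs ys in auto)
  finally show "mval f (xs @ [1]) (ys @ [1]) = mval (\<lambda>us. f (us @ [1])) xs ys" .
qed

end

context quasi_hopf_superalgebra
begin

section \<open>Linearity of the structure maps\<close>

lemma lin_antipode [intro]: "lin f \<Longrightarrow> lin (\<lambda>x. S (f x))"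
  using antipode_linear by (simp add: lin_iff)

lemma counit_add: "\<epsilon> (a + b) = \<epsilon> a + \<epsilon> b" and counit_scale: "\<epsilon> (k *s a) = k * \<epsilon> a"
  using counit_linear by (auto simp: Vector_Spaces.linear_iff)

lemma lin_counit: "lin f \<Longrightarrow> lin (\<lambda>x. \<epsilon> (f x) *s b)"
  by (simp add: lin_iff counit_add counit_scale scale_left_distrib)

lemma lin_counit_scale: "lin (\<lambda>x. \<epsilon> x *s b)"
  by (intro lin_counit lin_ident)

lemma lin_comult:
  assumes f: "multilinear 2 f"
  shows "lin (\<lambda>a. lin_ext scale f (\<Delta> a))"
  unfolding lin_iff
proof (intro conjI allI)
  fix a b k
  have "mequiv 2 (\<Delta> (a + b)) (\<Delta> a + \<Delta> b)" "mequiv 2 (\<Delta> (k *s a)) (tscale k (\<Delta> a))"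
    by (intro mequiv_teq has_length_add has_length_tscale comult_length comult_add comult_scale)+
  thus "lin_ext scale f (\<Delta> (a + b)) = lin_ext scale f (\<Delta> a) + lin_ext scale f (\<Delta> b)"
    "lin_ext scale f (\<Delta> (k *s a)) = k *s lin_ext scale f (\<Delta> a)"
    using f by (simp_all add: mequiv_def lin_ext_add lin_ext_tscale)
qed

text \<open>
  The coproduct of a homogeneous element has a representative whose terms are homogeneous with
  total degree \<open>d\<close>. Terms of a length other than 2 may occur in it; the cut-off in \<open>lin_ext_teq\<close>
  discards them.
\<close>

lemma comult_homogeneous_eqI:
  assumes a: "a \<in> gr d" and f: "multilinear 2 f" and g: "multilinear 2 g"
    and eq: "\<And>p q dp dq. p \<in> gr dp \<Longrightarrow> q \<in> gr dq \<Longrightarrow> d = dp + dq \<Longrightarrow> f [p, q] = g [p, q]"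
  shows "lin_ext scale f (\<Delta> a) = lin_ext scale g (\<Delta> a)"
proof -
  obtain s where s: "s \<approx> \<Delta> a"
    "\<And>xs. xs \<in> Poly_Mapping.keys s \<Longrightarrow> \<exists>ds. homogeneous_list xs ds \<and> sum_list ds = d"
    using comult_gr[OF a] unfolding homogeneous_tensor_def by blast
  let ?r = "\<lambda>h xs. if length xs = 2 then h xs else 0 :: 'a"
  have r: "lin_ext scale h (\<Delta> a) = lin_ext scale (?r h) s" if "multilinear 2 h" for h
    using lin_ext_teq[OF that s(1)] lin_ext_cong_length[OF comult_length, of h "?r h" a] by simp
  have "lin_ext scale (?r f) s = lin_ext scale (?r g) s"
    unfolding lin_ext_def
  proof (intro sum.cong refl arg_cong2[where f = scale])
    fix xs assume "xs \<in> Poly_Mapping.keys s"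
    from s(2)[OF this] show "?r f xs = ?r g xs"
      using eq length_numeral_cases(1)[of xs] by (auto simp: list_all2_Cons1)
  qed
  thus ?thesis using r f g by simp
qed

section \<open>Evaluation of the tensors in the axioms\<close>

lemma lin_ext_comult_counit:
  assumes h: "lin h"
  shows "lin_ext scale (\<lambda>ps. \<epsilon> (ps ! 0) *s h (ps ! 1)) (\<Delta> a) = h a"
    "lin_ext scale (\<lambda>ps. \<epsilon> (ps ! 1) *s h (ps ! 0)) (\<Delta> a) = h a"
proof -
  let ?h = "\<lambda>xs. h (xs ! 0)"
  let ?l = "tmap [scalar_leg \<epsilon>, id_leg] (\<Delta> a)" and ?r = "tmap [id_leg, scalar_leg \<epsilon>] (\<Delta> a)"
  have ml: "multilinear (Suc 0) ?h"
    using h by (simp add: multilinear1_iff)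
  have len: "has_length (Suc 0) ?l" "has_length (Suc 0) ?r"
    using has_length_tmap[OF comult_length, of "[scalar_leg \<epsilon>, id_leg]" "[0, 1]"]
      has_length_tmap[OF comult_length, of "[id_leg, scalar_leg \<epsilon>]" "[1, 0]"]
    by (simp_all add: has_length_tscale)
  have l: "lin_ext scale ?h ?l = lin_ext scale (\<lambda>ps. \<epsilon> (ps ! 0) *s h (ps ! 1)) (\<Delta> a)"
    and r: "lin_ext scale ?h ?r = lin_ext scale (\<lambda>ps. \<epsilon> (ps ! 1) *s h (ps ! 0)) (\<Delta> a)"
    unfolding tmap_def lin_ext_lin_ext
    by (rule lin_ext_cong_length[OF comult_length]; drule length_numeral_cases(1);
        force simp: lin_ext_tprod lin_ext_tscale)+
  have "mequiv (Suc 0) ?l (pure [a])" "mequiv (Suc 0) ?r (pure [a])"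
    by (intro mequiv_teq len counit_left counit_right; simp)+
  thus "lin_ext scale (\<lambda>ps. \<epsilon> (ps ! 0) *s h (ps ! 1)) (\<Delta> a) = h a"
    "lin_ext scale (\<lambda>ps. \<epsilon> (ps ! 1) *s h (ps ! 0)) (\<Delta> a) = h a"
    using ml l r by (auto simp: mequiv_def)
qed

lemma lin_ext_comult_one:
  assumes "multilinear 2 f"
  shows "lin_ext scale f (\<Delta> 1) = f [1, 1]"
proof -
  have "mequiv 2 (\<Delta> 1) (pure [1, 1])"
    by (intro mequiv_teq comult_length comult_one) simp
  with assms show ?thesis by (simp add: mequiv_def)
qed

lemma lin_ext_coassociator_counit:
  assumes f: "multilinear 2 f"
  shows "lin_ext scale (\<lambda>xs. \<epsilon> (xs ! 1) *s f [xs ! 0, xs ! 2]) \<Phi> = f [1, 1]"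
proof -
  let ?t = "tmap [id_leg, scalar_leg \<epsilon>, id_leg] \<Phi>"
  have "has_length 2 ?t"
    using has_length_tmap[OF coassociator_length(1), of "[id_leg, scalar_leg \<epsilon>, id_leg]" "[1, 0, 1]"]
    by (simp add: has_length_tscale numeral_eq_Suc)
  hence "mequiv 2 ?t (pure [1, 1])"
    by (intro mequiv_teq counit_coassociator) simp_all
  moreover have "lin_ext scale f ?t = lin_ext scale (\<lambda>xs. \<epsilon> (xs ! 1) *s f [xs ! 0, xs ! 2]) \<Phi>"
    unfolding tmap_def lin_ext_lin_ext
    by (rule lin_ext_cong_length[OF coassociator_length(1)]; drule length_numeral_cases(2);
        force simp: lin_ext_tprod lin_ext_tscale)
  ultimately show ?thesis using f by (simp add: mequiv_def)
qed

text \<open>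
  The coproduct applied to one of the three legs of the coassociator, which is how the coproduct enters the
  pentagon equation.
\<close>

definition "\<Delta>\<^sub>1 = tmap [\<Delta>, id_leg, id_leg] \<Phi>"
definition "\<Delta>\<^sub>2 = tmap [id_leg, \<Delta>, id_leg] \<Phi>"
definition "\<Delta>\<^sub>3 = tmap [id_leg, id_leg, \<Delta>] \<Phi>"

lemma lin_ext_comult_leg:
  "lin_ext scale f \<Delta>\<^sub>1 = lin_ext scale (\<lambda>xs. lin_ext scale (\<lambda>ps. f (ps @ [xs ! 1, xs ! 2])) (\<Delta> (xs ! 0))) \<Phi>"
  "lin_ext scale f \<Delta>\<^sub>2 = lin_ext scale (\<lambda>xs. lin_ext scale (\<lambda>ps. f ([xs ! 0] @ ps @ [xs ! 2])) (\<Delta> (xs ! 1))) \<Phi>"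
  "lin_ext scale f \<Delta>\<^sub>3 = lin_ext scale (\<lambda>xs. lin_ext scale (\<lambda>ps. f ([xs ! 0, xs ! 1] @ ps)) (\<Delta> (xs ! 2))) \<Phi>"
  unfolding \<Delta>\<^sub>1_def \<Delta>\<^sub>2_def \<Delta>\<^sub>3_def tmap_def lin_ext_lin_ext
  by (rule lin_ext_cong_length[OF coassociator_length(1)]; drule length_numeral_cases(2);
      force simp: lin_ext_tprod)+

lemma has_length_comult_leg: "has_length 4 \<Delta>\<^sub>1" "has_length 4 \<Delta>\<^sub>2" "has_length 4 \<Delta>\<^sub>3"
  using has_length_tmap[OF coassociator_length(1), of "[\<Delta>, id_leg, id_leg]" "[2, 1, 1]"]
    has_length_tmap[OF coassociator_length(1), of "[id_leg, \<Delta>, id_leg]" "[1, 2, 1]"]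
    has_length_tmap[OF coassociator_length(1), of "[id_leg, id_leg, \<Delta>]" "[1, 1, 2]"]
  by (simp_all add: \<Delta>\<^sub>1_def \<Delta>\<^sub>2_def \<Delta>\<^sub>3_def comult_length comult_length[unfolded numeral_2_eq_2] numeral_eq_Suc)

lemma has_length_pad:
  assumes "has_length n t"
  shows "has_length (Suc n) (t \<otimes>\<^sub>t pure [1])" "has_length (Suc n) (pure [1] \<otimes>\<^sub>t t)"
  using has_length_tprod[OF assms, of 1 "pure [1]"] has_length_tprod[OF _ assms, of 1 "pure [1]"]
  by simp_all

lemma mequiv_pentagon:
  "mequiv 4 (\<Delta>\<^sub>1 \<bullet> \<Delta>\<^sub>3) ((\<Phi> \<otimes>\<^sub>t pure [1]) \<bullet> \<Delta>\<^sub>2 \<bullet> (pure [1] \<otimes>\<^sub>t \<Phi>))"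
  using has_length_comult_leg has_length_pad[OF coassociator_length(1)] pentagon
  unfolding \<Delta>\<^sub>1_def \<Delta>\<^sub>2_def \<Delta>\<^sub>3_def by (intro mequiv_teq has_length_tmult) simp_all

lemma mequiv_coassociator_inverse:
  "mequiv 3 (\<Phi> \<bullet> \<Phi>inv) (pure [1, 1, 1])" "mequiv 3 (\<Phi>inv \<bullet> \<Phi>) (pure [1, 1, 1])"
  by (intro mequiv_teq has_length_tmult coassociator_length coassociator_inverse; simp)+

section \<open>Counit and coassociator\<close>

lemma multilinear_counit_second:
  "multilinear 3 f \<Longrightarrow> multilinear 4 (\<lambda>ts. \<epsilon> (ts ! 1) *s f [ts ! 0, ts ! 2, ts ! 3])"
  by (rule multilinear4I; simp; intro lin_counit_scale lin_scale multilinear_lin3)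

lemma multilinear_counit_third:
  "multilinear 3 f \<Longrightarrow> multilinear 4 (\<lambda>ts. \<epsilon> (ts ! 2) *s f [ts ! 0, ts ! 1, ts ! 3])"
  by (rule multilinear4I; simp; intro lin_counit_scale lin_scale multilinear_lin3)

text \<open>
  Applying \<open>\<epsilon>\<close> to the second slot is multiplicative, as \<open>\<epsilon>\<close> is an even algebra map: if one of the two
  second entries is odd, both sides vanish, and otherwise these entries contribute no sign.
\<close>

lemma mval_counit_second:
  assumes f: "multilinear 3 f" and len: "length xs = 4" "length ys = 4"
  shows "mval (\<lambda>ts. \<epsilon> (ts ! 1) *s f [ts ! 0, ts ! 2, ts ! 3]) xs ys
    = \<epsilon> (xs ! 1) *s \<epsilon> (ys ! 1) *s mval f [xs ! 0, xs ! 2, xs ! 3] [ys ! 0, ys ! 2, ys ! 3]"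
proof (rule multilinear_eq_homogeneousI2[OF _ _ _ _ _ len])
  note f' = multilinear_counit_second[OF f]
  show "multilinear 4 (\<lambda>xs. mval (\<lambda>ts. \<epsilon> (ts ! 1) *s f [ts ! 0, ts ! 2, ts ! 3]) xs ys)"
    if "length ys = 4" for ys
    by (rule multilinear_mval_left[OF f' that])
  show "multilinear 4 (mval (\<lambda>ts. \<epsilon> (ts ! 1) *s f [ts ! 0, ts ! 2, ts ! 3]) xs)"
    if "length xs = 4" for xs
    by (rule multilinear_mval_right[OF f' that])
  show "multilinear 4 (\<lambda>xs. \<epsilon> (xs ! 1) *s \<epsilon> (ys ! 1) *s mval f [xs ! 0, xs ! 2, xs ! 3] [ys ! 0, ys ! 2, ys ! 3])"
    for ys :: "'a list"
    by (intro multilinear_counit_second multilinear_scale multilinear_mval_left[OF f]) simp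
  show "multilinear 4 (\<lambda>ys. \<epsilon> (xs ! 1) *s \<epsilon> (ys ! 1) *s mval f [xs ! 0, xs ! 2, xs ! 3] [ys ! 0, ys ! 2, ys ! 3])"
    for xs :: "'a list"
    by (intro multilinear_scale multilinear_counit_second multilinear_mval_right[OF f]) simp
  fix xs ys ds es
  assume *: "length xs = 4" "length ys = 4" "homogeneous_list xs ds" "homogeneous_list ys es"
  obtain x0 x1 x2 x3 d0 d1 d2 d3 where x: "xs = [x0, x1, x2, x3]" "ds = [d0, d1, d2, d3]"
    "x0 \<in> gr d0" "x1 \<in> gr d1" "x2 \<in> gr d2" "x3 \<in> gr d3"
    using * length_numeral_cases(3)[of xs] by (auto simp: list_all2_Cons1)
  obtain y0 y1 y2 y3 e0 e1 e2 e3 where y: "ys = [y0, y1, y2, y3]" "es = [e0, e1, e2, e3]"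
    "y0 \<in> gr e0" "y1 \<in> gr e1" "y2 \<in> gr e2" "y3 \<in> gr e3"
    using * length_numeral_cases(3)[of ys] by (auto simp: list_all2_Cons1)
  have "mval (\<lambda>ts. \<epsilon> (ts ! 1) *s f [ts ! 0, ts ! 2, ts ! 3]) xs ys
      = mult_sign ds es *s \<epsilon> (x1 * y1) *s f [x0 * y0, x2 * y2, x3 * y3]"
    using * x y by (subst mval_homogeneous[OF f']) auto
  also have "\<dots> = \<epsilon> x1 *s \<epsilon> y1 *s mult_sign [d0, d2, d3] [e0, e2, e3] *s f [x0 * y0, x2 * y2, x3 * y3]"
    using counit_gr x y by (cases d1; cases e1) (auto simp: counit_mult mult_sign_3 mult_sign_4 mult_ac)
  also have "mult_sign [d0, d2, d3] [e0, e2, e3] *s f [x0 * y0, x2 * y2, x3 * y3] = mval f [x0, x2, x3] [y0, y2, y3]"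
    using x y by (subst mval_homogeneous[OF f, of _ _ "[d0, d2, d3]" "[e0, e2, e3]"]) auto
  finally show "mval (\<lambda>ts. \<epsilon> (ts ! 1) *s f [ts ! 0, ts ! 2, ts ! 3]) xs ys
    = \<epsilon> (xs ! 1) *s \<epsilon> (ys ! 1) *s mval f [xs ! 0, xs ! 2, xs ! 3] [ys ! 0, ys ! 2, ys ! 3]"
    by (simp add: x y)
qed

lemma mval_counit_third:
  assumes f: "multilinear 3 f" and len: "length xs = 4" "length ys = 4"
  shows "mval (\<lambda>ts. \<epsilon> (ts ! 2) *s f [ts ! 0, ts ! 1, ts ! 3]) xs ys
    = \<epsilon> (xs ! 2) *s \<epsilon> (ys ! 2) *s mval f [xs ! 0, xs ! 1, xs ! 3] [ys ! 0, ys ! 1, ys ! 3]"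
proof (rule multilinear_eq_homogeneousI2[OF _ _ _ _ _ len])
  note f' = multilinear_counit_third[OF f]
  show "multilinear 4 (\<lambda>xs. mval (\<lambda>ts. \<epsilon> (ts ! 2) *s f [ts ! 0, ts ! 1, ts ! 3]) xs ys)"
    if "length ys = 4" for ys
    by (rule multilinear_mval_left[OF f' that])
  show "multilinear 4 (mval (\<lambda>ts. \<epsilon> (ts ! 2) *s f [ts ! 0, ts ! 1, ts ! 3]) xs)"
    if "length xs = 4" for xs
    by (rule multilinear_mval_right[OF f' that])
  show "multilinear 4 (\<lambda>xs. \<epsilon> (xs ! 2) *s \<epsilon> (ys ! 2) *s mval f [xs ! 0, xs ! 1, xs ! 3] [ys ! 0, ys ! 1, ys ! 3])"
    for ys :: "'a list"
    by (intro multilinear_counit_third multilinear_scale multilinear_mval_left[OF f]) simp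
  show "multilinear 4 (\<lambda>ys. \<epsilon> (xs ! 2) *s \<epsilon> (ys ! 2) *s mval f [xs ! 0, xs ! 1, xs ! 3] [ys ! 0, ys ! 1, ys ! 3])"
    for xs :: "'a list"
    by (intro multilinear_scale multilinear_counit_third multilinear_mval_right[OF f]) simp
  fix xs ys ds es
  assume *: "length xs = 4" "length ys = 4" "homogeneous_list xs ds" "homogeneous_list ys es"
  obtain x0 x1 x2 x3 d0 d1 d2 d3 where x: "xs = [x0, x1, x2, x3]" "ds = [d0, d1, d2, d3]"
    "x0 \<in> gr d0" "x1 \<in> gr d1" "x2 \<in> gr d2" "x3 \<in> gr d3"
    using * length_numeral_cases(3)[of xs] by (auto simp: list_all2_Cons1)
  obtain y0 y1 y2 y3 e0 e1 e2 e3 where y: "ys = [y0, y1, y2, y3]" "es = [e0, e1, e2, e3]"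
    "y0 \<in> gr e0" "y1 \<in> gr e1" "y2 \<in> gr e2" "y3 \<in> gr e3"
    using * length_numeral_cases(3)[of ys] by (auto simp: list_all2_Cons1)
  have "mval (\<lambda>ts. \<epsilon> (ts ! 2) *s f [ts ! 0, ts ! 1, ts ! 3]) xs ys
      = mult_sign ds es *s \<epsilon> (x2 * y2) *s f [x0 * y0, x1 * y1, x3 * y3]"
    using * x y by (subst mval_homogeneous[OF f']) auto
  also have "\<dots> = \<epsilon> x2 *s \<epsilon> y2 *s mult_sign [d0, d1, d3] [e0, e1, e3] *s f [x0 * y0, x1 * y1, x3 * y3]"
    using counit_gr x y by (cases d2; cases e2) (auto simp: counit_mult mult_sign_3 mult_sign_4 mult_ac)
  also have "mult_sign [d0, d1, d3] [e0, e1, e3] *s f [x0 * y0, x1 * y1, x3 * y3] = mval f [x0, x1, x3] [y0, y1, y3]"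
    using x y by (subst mval_homogeneous[OF f, of _ _ "[d0, d1, d3]" "[e0, e1, e3]"]) auto
  finally show "mval (\<lambda>ts. \<epsilon> (ts ! 2) *s f [ts ! 0, ts ! 1, ts ! 3]) xs ys
    = \<epsilon> (xs ! 2) *s \<epsilon> (ys ! 2) *s mval f [xs ! 0, xs ! 1, xs ! 3] [ys ! 0, ys ! 1, ys ! 3]"
    by (simp add: x y)
qed

lemma multilinear_cons_comult:
  assumes f: "multilinear 3 f"
  shows "multilinear 2 (\<lambda>xs. lin_ext scale (\<lambda>ps. f (xs ! 0 # ps)) (\<Delta> (xs ! 1)))"
    "multilinear 2 (\<lambda>xs. lin_ext scale (\<lambda>ps. f (ps @ [xs ! 1])) (\<Delta> (xs ! 0)))"
proof -
  show "multilinear 2 (\<lambda>xs. lin_ext scale (\<lambda>ps. f (xs ! 0 # ps)) (\<Delta> (xs ! 1)))"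
  proof (rule multilinear2I)
    show "lin (\<lambda>x. lin_ext scale (\<lambda>ps. f ([x, y] ! 0 # ps)) (\<Delta> ([x, y] ! 1)))" for y
      using multilinear_lin[OF f, of "[]"] comult_length[of y]
      by (auto intro!: lin_lin_ext simp: has_length_def)
    show "lin (\<lambda>y. lin_ext scale (\<lambda>ps. f ([x, y] ! 0 # ps)) (\<Delta> ([x, y] ! 1)))" for x
      using lin_comult[OF multilinear_append_arg[OF f, of "[x]" 2 "[]"]] by simp
  qed
  show "multilinear 2 (\<lambda>xs. lin_ext scale (\<lambda>ps. f (ps @ [xs ! 1])) (\<Delta> (xs ! 0)))"
  proof (rule multilinear2I)
    show "lin (\<lambda>y. lin_ext scale (\<lambda>ps. f (ps @ [[x, y] ! 1])) (\<Delta> ([x, y] ! 0)))" for x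
      using multilinear_lin[OF f, of _ "[]"] comult_length[of x]
      by (auto intro!: lin_lin_ext simp: has_length_def)
    show "lin (\<lambda>x. lin_ext scale (\<lambda>ps. f (ps @ [[x, y] ! 1])) (\<Delta> ([x, y] ! 0)))" for y
      using lin_comult[OF multilinear_append_arg[OF f, of "[]" 2 "[y]"]] by simp
  qed
qed

text \<open>
  The tensors \<open>1 \<otimes> (\<epsilon> \<otimes> 1 \<otimes> 1)\<Phi>\<close> and \<open>(1 \<otimes> 1 \<otimes> \<epsilon>)\<Phi> \<otimes> 1\<close>. They are what the pentagon equation
  leaves over when \<open>\<epsilon>\<close> is applied to its second or third slot.
\<close>

definition "counit_leg\<^sub>1 = pure [1] \<otimes>\<^sub>t tmap [scalar_leg \<epsilon>, id_leg, id_leg] \<Phi>"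
definition "counit_leg\<^sub>3 = tmap [id_leg, id_leg, scalar_leg \<epsilon>] \<Phi> \<otimes>\<^sub>t pure [1]"

lemma lin_ext_counit_leg:
  "lin_ext scale f counit_leg\<^sub>1 = lin_ext scale (\<lambda>xs. \<epsilon> (xs ! 0) *s f [1, xs ! 1, xs ! 2]) \<Phi>"
  "lin_ext scale f counit_leg\<^sub>3 = lin_ext scale (\<lambda>xs. \<epsilon> (xs ! 2) *s f [xs ! 0, xs ! 1, 1]) \<Phi>"
  unfolding counit_leg\<^sub>1_def counit_leg\<^sub>3_def tmap_def lin_ext_tprod lin_ext_lin_ext lin_ext_pure
  by (rule lin_ext_cong_length[OF coassociator_length(1)]; drule length_numeral_cases(2);
      force simp: lin_ext_tprod lin_ext_tscale)+

lemma has_length_counit_leg: "has_length 3 counit_leg\<^sub>1" "has_length 3 counit_leg\<^sub>3"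
proof -
  have "has_length 2 (tmap [scalar_leg \<epsilon>, id_leg, id_leg] \<Phi>)"
    "has_length 2 (tmap [id_leg, id_leg, scalar_leg \<epsilon>] \<Phi>)"
    using has_length_tmap[OF coassociator_length(1), of "[scalar_leg \<epsilon>, id_leg, id_leg]" "[0, 1, 1]"]
      has_length_tmap[OF coassociator_length(1), of "[id_leg, id_leg, scalar_leg \<epsilon>]" "[1, 1, 0]"]
    by (simp_all add: has_length_tscale numeral_eq_Suc)
  from has_length_pad(2)[OF this(1)] has_length_pad(1)[OF this(2)]
  show "has_length 3 counit_leg\<^sub>1" "has_length 3 counit_leg\<^sub>3"
    by (simp_all add: counit_leg\<^sub>1_def counit_leg\<^sub>3_def)
qed

lemma pentagon_eval:
  assumes f: "multilinear 4 f"
  shows "lin_ext scale (\<lambda>us. lin_ext scale (mval f us) \<Delta>\<^sub>3) \<Delta>\<^sub>1 =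
    lin_ext scale (\<lambda>xs. lin_ext scale (mval (\<lambda>ts. lin_ext scale (\<lambda>us. mval f ts (1 # us)) \<Phi>) (xs @ [1])) \<Delta>\<^sub>2) \<Phi>"
proof -
  have "lin_ext scale f (\<Delta>\<^sub>1 \<bullet> \<Delta>\<^sub>3) = lin_ext scale f ((\<Phi> \<otimes>\<^sub>t pure [1]) \<bullet> \<Delta>\<^sub>2 \<bullet> (pure [1] \<otimes>\<^sub>t \<Phi>))"
    using mequiv_pentagon f by (simp add: mequiv_def)
  thus ?thesis
    by (simp add: lin_ext_tmult lin_ext_tprod)
qed

text \<open>
  This is the pentagon equation with \<open>\<epsilon>\<close> in the second slot. On the left,
  \<open>(1 \<otimes> \<epsilon>)\<Delta> = 1\<close> reduces \<open>(\<Delta> \<otimes> 1 \<otimes> 1)\<Phi>\<close> to \<open>\<Phi>\<close>, and the normalisation of \<open>\<Phi>\<close> reduces \<open>(1 \<otimes> 1 \<otimes> \<Delta>)\<Phi>\<close> to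
  \<open>1 \<otimes> \<Delta>(1)\<close>. On the right, the normalisation removes \<open>\<Phi> \<otimes> 1\<close>, and \<open>(\<epsilon> \<otimes> 1)\<Delta> = 1\<close> reduces \<open>(1 \<otimes> \<Delta> \<otimes> 1)\<Phi>\<close> to \<open>\<Phi>\<close>,
  so that \<open>\<Phi>\<close> remains multiplied by the third factor.
\<close>

lemma coassociator_counit_leg1: "mequiv 3 \<Phi> (\<Phi> \<bullet> counit_leg\<^sub>1)"
  unfolding mequiv_def
proof (intro allI impI)
  fix f assume f: "multilinear 3 f"
  note \<Phi> = coassociator_length(1)
  let ?f = "\<lambda>f ts. \<epsilon> (ts ! 1) *s f [ts ! 0, ts ! 2, ts ! 3]"
  let ?g = "\<lambda>v. lin_ext scale (mval f v) counit_leg\<^sub>1"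
  have g: "multilinear 3 ?g"
    by (rule multilinear_lin_ext_mval(1)[OF has_length_counit_leg(1) f])
  have "lin_ext scale (\<lambda>us. lin_ext scale (mval (?f f) us) \<Delta>\<^sub>3) \<Delta>\<^sub>1 = lin_ext scale (?f f) \<Delta>\<^sub>1"
  proof (rule lin_ext_cong_length[OF has_length_comult_leg(1)])
    fix us :: "'a list" assume us: "length us = 4"
    let ?u = "[us ! 0, us ! 2, us ! 3]"
    let ?h = "\<lambda>xs. lin_ext scale (\<lambda>ps. mval f ?u (xs ! 0 # ps)) (\<Delta> (xs ! 1))"
    have u: "multilinear 3 (mval f ?u)" by (rule multilinear_mval_right[OF f]) simp
    have h: "multilinear 2 ?h" by (rule multilinear_cons_comult(1)[OF u])
    have "lin_ext scale (mval (?f f) us) \<Delta>\<^sub>3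
        = lin_ext scale (\<lambda>xs. \<epsilon> (xs ! 1) *s \<epsilon> (us ! 1) *s ?h [xs ! 0, xs ! 2]) \<Phi>"
      unfolding lin_ext_comult_leg
    proof (rule lin_ext_cong_3[OF \<Phi>])
      fix x y z
      have "lin_ext scale (\<lambda>ps. mval (?f f) us ([x, y] @ ps)) (\<Delta> z)
          = lin_ext scale (\<lambda>ps. \<epsilon> y *s \<epsilon> (us ! 1) *s mval f ?u (x # ps)) (\<Delta> z)"
        using us by (intro lin_ext_cong_2[OF comult_length]) (simp add: mval_counit_second[OF f] mult_ac del: One_nat_def)
      thus "lin_ext scale (\<lambda>ps. mval (?f f) us ([[x, y, z] ! 0, [x, y, z] ! 1] @ ps)) (\<Delta> ([x, y, z] ! 2))
          = \<epsilon> ([x, y, z] ! 1) *s \<epsilon> (us ! 1) *s ?h [[x, y, z] ! 0, [x, y, z] ! 2]"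
        by (simp add: lin_ext_scale_fun del: scale_scale)
    qed
    also have "\<dots> = \<epsilon> (us ! 1) *s ?h [1, 1]"
      by (rule lin_ext_coassociator_counit[OF multilinear_scale[OF h]])
    also have "?h [1, 1] = f ?u"
      using lin_ext_comult_one[OF multilinear_append_arg[OF u, of "[1]" 2 "[]"]] mval_one_3[OF f, of ?u] by simp
    finally show "lin_ext scale (mval (?f f) us) \<Delta>\<^sub>3 = ?f f us" .
  qed
  also have "\<dots> = lin_ext scale f \<Phi>"
    unfolding lin_ext_comult_leg
  proof (rule lin_ext_cong_3[OF \<Phi>])
    fix x y z
    have "lin_ext scale (\<lambda>ps. ?f f (ps @ [y, z])) (\<Delta> x)
        = lin_ext scale (\<lambda>ps. \<epsilon> (ps ! 1) *s f [ps ! 0, y, z]) (\<Delta> x)"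
      by (intro lin_ext_cong_2[OF comult_length]) simp
    also have "\<dots> = f [x, y, z]"
      by (rule lin_ext_comult_counit(2)[OF multilinear_lin3(1)[OF f]])
    finally show "lin_ext scale (\<lambda>ps. ?f f (ps @ [[x, y, z] ! 1, [x, y, z] ! 2])) (\<Delta> ([x, y, z] ! 0)) = f [x, y, z]"
      by simp
  qed
  finally have left: "lin_ext scale (\<lambda>us. lin_ext scale (mval (?f f) us) \<Delta>\<^sub>3) \<Delta>\<^sub>1 = lin_ext scale f \<Phi>" .
  have inner: "lin_ext scale (\<lambda>us. mval (?f f) ts (1 # us)) \<Phi> = ?f ?g ts" if "length ts = 4" for ts
  proof -
    have "lin_ext scale (\<lambda>us. mval (?f f) ts (1 # us)) \<Phi>
        = lin_ext scale (\<lambda>us. \<epsilon> (ts ! 1) *s \<epsilon> (us ! 0) *s mval f [ts ! 0, ts ! 2, ts ! 3] [1, us ! 1, us ! 2]) \<Phi>"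
      using that by (intro lin_ext_cong_3[OF \<Phi>]) (simp add: mval_counit_second[OF f] del: One_nat_def)
    thus ?thesis by (simp add: lin_ext_counit_leg lin_ext_scale_fun del: scale_scale)
  qed
  have "lin_ext scale (\<lambda>xs. lin_ext scale (mval (\<lambda>ts. lin_ext scale (\<lambda>us. mval (?f f) ts (1 # us)) \<Phi>) (xs @ [1])) \<Delta>\<^sub>2) \<Phi>
      = lin_ext scale (\<lambda>xs. \<epsilon> (xs ! 1) *s lin_ext scale (mval ?g [xs ! 0, xs ! 2, 1]) \<Phi>) \<Phi>"
  proof (rule lin_ext_cong_3[OF \<Phi>])
    fix x y z
    have "lin_ext scale (mval (\<lambda>ts. lin_ext scale (\<lambda>us. mval (?f f) ts (1 # us)) \<Phi>) ([x, y, z] @ [1])) \<Delta>\<^sub>2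
        = lin_ext scale (mval (?f ?g) [x, y, z, 1]) \<Delta>\<^sub>2"
    proof (rule lin_ext_cong_length[OF has_length_comult_leg(2)])
      fix ys :: "'a list" assume "length ys = 4"
      thus "mval (\<lambda>ts. lin_ext scale (\<lambda>us. mval (?f f) ts (1 # us)) \<Phi>) ([x, y, z] @ [1]) ys = mval (?f ?g) [x, y, z, 1] ys"
        unfolding append.simps by (intro mval_cong[where n = 4] inner) simp_all
    qed
    also have "\<dots> = lin_ext scale (\<lambda>ys. \<epsilon> y *s mval ?g [x, z, 1] ys) \<Phi>"
      unfolding lin_ext_comult_leg
    proof (rule lin_ext_cong_3[OF \<Phi>])
      fix p q r
      have "lin_ext scale (\<lambda>ps. mval (?f ?g) [x, y, z, 1] ([p] @ ps @ [r])) (\<Delta> q)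
          = lin_ext scale (\<lambda>ps. \<epsilon> (ps ! 0) *s \<epsilon> y *s mval ?g [x, z, 1] [p, ps ! 1, r]) (\<Delta> q)"
        by (intro lin_ext_cong_2[OF comult_length]) (simp add: mval_counit_second[OF g] mult_ac del: One_nat_def)
      also have "\<dots> = \<epsilon> y *s mval ?g [x, z, 1] [p, q, r]"
        by (rule lin_ext_comult_counit(1)[OF lin_scale[OF multilinear_lin3(2)[OF multilinear_mval_right[OF g]]]]) simp
      finally show "lin_ext scale (\<lambda>ps. mval (?f ?g) [x, y, z, 1] ([[p, q, r] ! 0] @ ps @ [[p, q, r] ! 2])) (\<Delta> ([p, q, r] ! 1))
          = \<epsilon> y *s mval ?g [x, z, 1] [p, q, r]" by simp
    qed
    finally show "lin_ext scale (mval (\<lambda>ts. lin_ext scale (\<lambda>us. mval (?f f) ts (1 # us)) \<Phi>) ([x, y, z] @ [1])) \<Delta>\<^sub>2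
        = \<epsilon> ([x, y, z] ! 1) *s lin_ext scale (mval ?g [[x, y, z] ! 0, [x, y, z] ! 2, 1]) \<Phi>"
      by (simp add: lin_ext_scale_fun)
  qed
  also have "\<dots> = lin_ext scale (\<lambda>xs. \<epsilon> (xs ! 1) *s (\<lambda>xs. lin_ext scale (mval ?g (xs @ [1])) \<Phi>) [xs ! 0, xs ! 2]) \<Phi>"
    by simp
  also have "\<dots> = lin_ext scale (mval ?g ([1, 1] @ [1])) \<Phi>"
    by (rule lin_ext_coassociator_counit[OF
          multilinear_append_arg[OF multilinear_lin_ext_mval(1)[OF \<Phi> g], of "[]" 2 "[1]", simplified]])
  also have "\<dots> = lin_ext scale ?g \<Phi>"
    using mval_one_3[OF g] by (intro lin_ext_cong_length[OF \<Phi>]) simp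
  finally show "lin_ext scale f \<Phi> = lin_ext scale f (\<Phi> \<bullet> counit_leg\<^sub>1)"
    using pentagon_eval[OF multilinear_counit_second[OF f]] left by (simp add: lin_ext_tmult)
qed

text \<open>
  The same with \<open>\<epsilon>\<close> in the third slot. Now \<open>(1 \<otimes> 1 \<otimes> \<Delta>)\<Phi>\<close> and \<open>(1 \<otimes> \<Delta> \<otimes> 1)\<Phi>\<close> reduce to \<open>\<Phi>\<close>, while the
  factors \<open>(\<Delta> \<otimes> 1 \<otimes> 1)\<Phi>\<close> and \<open>1 \<otimes> \<Phi>\<close> become trivial.
\<close>

lemma coassociator_counit_leg3: "mequiv 3 \<Phi> (counit_leg\<^sub>3 \<bullet> \<Phi>)"
  unfolding mequiv_def
proof (intro allI impI)
  fix f assume f: "multilinear 3 f"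
  note \<Phi> = coassociator_length(1)
  let ?f = "\<lambda>f ts. \<epsilon> (ts ! 2) *s f [ts ! 0, ts ! 1, ts ! 3]"
  let ?g = "\<lambda>v. lin_ext scale (mval f v) \<Phi>"
  have g: "multilinear 3 ?g"
    by (rule multilinear_lin_ext_mval(1)[OF \<Phi> f])
  have "lin_ext scale (\<lambda>us. lin_ext scale (mval (?f f) us) \<Delta>\<^sub>3) \<Delta>\<^sub>1 = lin_ext scale (?f ?g) \<Delta>\<^sub>1"
  proof (rule lin_ext_cong_length[OF has_length_comult_leg(1)])
    fix us :: "'a list" assume us: "length us = 4"
    let ?u = "[us ! 0, us ! 1, us ! 3]"
    have u: "multilinear 3 (mval f ?u)" by (rule multilinear_mval_right[OF f]) simp
    have "lin_ext scale (mval (?f f) us) \<Delta>\<^sub>3 = lin_ext scale (\<lambda>xs. \<epsilon> (us ! 2) *s mval f ?u xs) \<Phi>"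
      unfolding lin_ext_comult_leg
    proof (rule lin_ext_cong_3[OF \<Phi>])
      fix x y z
      have "lin_ext scale (\<lambda>ps. mval (?f f) us ([x, y] @ ps)) (\<Delta> z)
          = lin_ext scale (\<lambda>ps. \<epsilon> (ps ! 0) *s \<epsilon> (us ! 2) *s mval f ?u [x, y, ps ! 1]) (\<Delta> z)"
        using us by (intro lin_ext_cong_2[OF comult_length]) (simp add: mval_counit_third[OF f] mult_ac del: One_nat_def)
      also have "\<dots> = \<epsilon> (us ! 2) *s mval f ?u [x, y, z]"
        by (rule lin_ext_comult_counit(1)[OF lin_scale[OF multilinear_lin3(3)[OF u]]])
      finally show "lin_ext scale (\<lambda>ps. mval (?f f) us ([[x, y, z] ! 0, [x, y, z] ! 1] @ ps)) (\<Delta> ([x, y, z] ! 2))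
          = \<epsilon> (us ! 2) *s mval f ?u [x, y, z]" by simp
    qed
    thus "lin_ext scale (mval (?f f) us) \<Delta>\<^sub>3 = ?f ?g us" by (simp add: lin_ext_scale_fun)
  qed
  also have "\<dots> = lin_ext scale (\<lambda>xs. \<epsilon> (xs ! 1) *s
      (\<lambda>xs. lin_ext scale (\<lambda>ps. ?g (ps @ [xs ! 1])) (\<Delta> (xs ! 0))) [xs ! 0, xs ! 2]) \<Phi>"
    unfolding lin_ext_comult_leg
  proof (rule lin_ext_cong_3[OF \<Phi>])
    fix x y z
    have "lin_ext scale (\<lambda>ps. ?f ?g (ps @ [y, z])) (\<Delta> x) = lin_ext scale (\<lambda>ps. \<epsilon> y *s ?g (ps @ [z])) (\<Delta> x)"
      by (intro lin_ext_cong_2[OF comult_length]) simp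
    thus "lin_ext scale (\<lambda>ps. ?f ?g (ps @ [[x, y, z] ! 1, [x, y, z] ! 2])) (\<Delta> ([x, y, z] ! 0))
      = \<epsilon> ([x, y, z] ! 1) *s
      (\<lambda>xs. lin_ext scale (\<lambda>ps. ?g (ps @ [xs ! 1])) (\<Delta> (xs ! 0))) [[x, y, z] ! 0, [x, y, z] ! 2]"
      by (simp add: lin_ext_scale_fun)
  qed
  also have "\<dots> = (\<lambda>xs. lin_ext scale (\<lambda>ps. ?g (ps @ [xs ! 1])) (\<Delta> (xs ! 0))) [1, 1]"
    by (rule lin_ext_coassociator_counit[OF multilinear_cons_comult(2)[OF g]])
  also have "\<dots> = ?g [1, 1, 1]"
    using lin_ext_comult_one[OF multilinear_append_arg[OF g, of "[]" 2 "[1]"]] by simp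
  also have "\<dots> = lin_ext scale f \<Phi>"
    using mval_one_3[OF f] by (intro lin_ext_cong_length[OF \<Phi>]) simp
  finally have left: "lin_ext scale (\<lambda>us. lin_ext scale (mval (?f f) us) \<Delta>\<^sub>3) \<Delta>\<^sub>1 = lin_ext scale f \<Phi>" .
  have inner: "lin_ext scale (\<lambda>us. mval (?f f) ts (1 # us)) \<Phi> = ?f f ts" if "length ts = 4" for ts
  proof -
    let ?t = "[ts ! 0, ts ! 1, ts ! 3]"
    have t: "multilinear 2 (\<lambda>xs. \<epsilon> (ts ! 2) *s mval f ?t (1 # xs))"
      using multilinear_append_arg[OF multilinear_mval_right[OF f, of ?t], of "[1]" 2 "[]"]
      by (intro multilinear_scale) simp
    have "lin_ext scale (\<lambda>us. mval (?f f) ts (1 # us)) \<Phi>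
        = lin_ext scale (\<lambda>us. \<epsilon> (us ! 1) *s (\<lambda>xs. \<epsilon> (ts ! 2) *s mval f ?t (1 # xs)) [us ! 0, us ! 2]) \<Phi>"
      using that by (intro lin_ext_cong_3[OF \<Phi>]) (simp add: mval_counit_third[OF f] mult_ac del: One_nat_def)
    also have "\<dots> = \<epsilon> (ts ! 2) *s mval f ?t (1 # [1, 1])"
      by (rule lin_ext_coassociator_counit[OF t])
    finally show ?thesis using mval_one_3[OF f, of ?t] by simp
  qed
  have "lin_ext scale (\<lambda>xs. lin_ext scale (mval (\<lambda>ts. lin_ext scale (\<lambda>us. mval (?f f) ts (1 # us)) \<Phi>) (xs @ [1])) \<Delta>\<^sub>2) \<Phi>
      = lin_ext scale (\<lambda>xs. \<epsilon> (xs ! 2) *s lin_ext scale (mval f [xs ! 0, xs ! 1, 1]) \<Phi>) \<Phi>"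
  proof (rule lin_ext_cong_3[OF \<Phi>])
    fix x y z
    have "lin_ext scale (mval (\<lambda>ts. lin_ext scale (\<lambda>us. mval (?f f) ts (1 # us)) \<Phi>) ([x, y, z] @ [1])) \<Delta>\<^sub>2
        = lin_ext scale (mval (?f f) [x, y, z, 1]) \<Delta>\<^sub>2"
    proof (rule lin_ext_cong_length[OF has_length_comult_leg(2)])
      fix ys :: "'a list" assume "length ys = 4"
      thus "mval (\<lambda>ts. lin_ext scale (\<lambda>us. mval (?f f) ts (1 # us)) \<Phi>) ([x, y, z] @ [1]) ys = mval (?f f) [x, y, z, 1] ys"
        unfolding append.simps by (intro mval_cong[where n = 4] inner) simp_all
    qed
    also have "\<dots> = lin_ext scale (\<lambda>ys. \<epsilon> z *s mval f [x, y, 1] ys) \<Phi>"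
      unfolding lin_ext_comult_leg
    proof (rule lin_ext_cong_3[OF \<Phi>])
      fix p q r
      have "lin_ext scale (\<lambda>ps. mval (?f f) [x, y, z, 1] ([p] @ ps @ [r])) (\<Delta> q)
          = lin_ext scale (\<lambda>ps. \<epsilon> (ps ! 1) *s \<epsilon> z *s mval f [x, y, 1] [p, ps ! 0, r]) (\<Delta> q)"
        by (intro lin_ext_cong_2[OF comult_length]) (simp add: mval_counit_third[OF f] mult_ac del: One_nat_def)
      also have "\<dots> = \<epsilon> z *s mval f [x, y, 1] [p, q, r]"
        by (rule lin_ext_comult_counit(2)[OF lin_scale[OF multilinear_lin3(2)[OF multilinear_mval_right[OF f]]]]) simp
      finally show "lin_ext scale (\<lambda>ps. mval (?f f) [x, y, z, 1] ([[p, q, r] ! 0] @ ps @ [[p, q, r] ! 2])) (\<Delta> ([p, q, r] ! 1))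
          = \<epsilon> z *s mval f [x, y, 1] [p, q, r]" by simp
    qed
    finally show "lin_ext scale (mval (\<lambda>ts. lin_ext scale (\<lambda>us. mval (?f f) ts (1 # us)) \<Phi>) ([x, y, z] @ [1])) \<Delta>\<^sub>2
        = \<epsilon> ([x, y, z] ! 2) *s lin_ext scale (mval f [[x, y, z] ! 0, [x, y, z] ! 1, 1]) \<Phi>"
      by (simp add: lin_ext_scale_fun)
  qed
  thus "lin_ext scale f \<Phi> = lin_ext scale f (counit_leg\<^sub>3 \<bullet> \<Phi>)"
    using pentagon_eval[OF multilinear_counit_third[OF f]] left
    by (simp add: lin_ext_tmult lin_ext_counit_leg)
qed

lemma coassociator_cancel_left:
  assumes "has_length 3 t" "mequiv 3 \<Phi> (\<Phi> \<bullet> t)"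
  shows "mequiv 3 (pure [1, 1, 1]) t"
proof -
  have one: "mequiv 3 (pure [1, 1, 1] \<bullet> t) t"
    using mequiv_tmult_one(2)[OF assms(1)] by (simp add: numeral_eq_Suc)
  have "mequiv 3 (\<Phi>inv \<bullet> \<Phi>) (\<Phi>inv \<bullet> (\<Phi> \<bullet> t))"
    using assms by (intro mequiv_tmult coassociator_length has_length_tmult) (simp_all add: mequiv_def)
  also have "mequiv 3 (\<Phi>inv \<bullet> (\<Phi> \<bullet> t)) (\<Phi>inv \<bullet> \<Phi> \<bullet> t)"
    by (rule mequiv_sym[OF mequiv_tmult_assoc[OF coassociator_length(2,1) assms(1)]])
  also have "mequiv 3 (\<Phi>inv \<bullet> \<Phi> \<bullet> t) (pure [1, 1, 1] \<bullet> t)"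
    using mequiv_coassociator_inverse(2) assms(1)
    by (intro mequiv_tmult has_length_tmult coassociator_length) (simp_all add: mequiv_def)
  also note one
  finally show ?thesis
    using mequiv_coassociator_inverse(2) by (simp add: mequiv_def)
qed

lemma coassociator_cancel_right:
  assumes "has_length 3 t" "mequiv 3 \<Phi> (t \<bullet> \<Phi>)"
  shows "mequiv 3 (pure [1, 1, 1]) t"
proof -
  have one: "mequiv 3 (t \<bullet> pure [1, 1, 1]) t"
    using mequiv_tmult_one(1)[OF assms(1)] by (simp add: numeral_eq_Suc)
  have "mequiv 3 (\<Phi> \<bullet> \<Phi>inv) (t \<bullet> \<Phi> \<bullet> \<Phi>inv)"
    using assms by (intro mequiv_tmult coassociator_length has_length_tmult) (simp_all add: mequiv_def)
  also have "mequiv 3 (t \<bullet> \<Phi> \<bullet> \<Phi>inv) (t \<bullet> (\<Phi> \<bullet> \<Phi>inv))"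
    by (rule mequiv_tmult_assoc[OF assms(1) coassociator_length(1,2)])
  also have "mequiv 3 (t \<bullet> (\<Phi> \<bullet> \<Phi>inv)) (t \<bullet> pure [1, 1, 1])"
    using mequiv_coassociator_inverse(1) assms(1)
    by (intro mequiv_tmult) (simp_all add: mequiv_def)
  also note one
  finally show ?thesis
    using mequiv_coassociator_inverse(1) by (simp add: mequiv_def)
qed

lemma lin_ext_coassociator_counit_first:
  assumes f: "multilinear 2 f"
  shows "lin_ext scale (\<lambda>xs. \<epsilon> (xs ! 0) *s f [xs ! 1, xs ! 2]) \<Phi> = f [1, 1]"
proof -
  let ?f = "\<lambda>xs. \<epsilon> (xs ! 0) *s f [xs ! 1, xs ! 2]"
  have "multilinear 3 ?f"
    by (rule multilinear3I; simp; intro lin_counit_scale lin_scale multilinear_lin2 f)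
  with coassociator_cancel_left[OF has_length_counit_leg(1) coassociator_counit_leg1]
  have "?f [1, 1, 1] = lin_ext scale ?f counit_leg\<^sub>1"
    unfolding mequiv_def by (metis (no_types, lifting) lin_ext_pure)
  thus ?thesis by (simp add: lin_ext_counit_leg counit_one)
qed

lemma lin_ext_coassociator_counit_last:
  assumes f: "multilinear 2 f"
  shows "lin_ext scale (\<lambda>xs. \<epsilon> (xs ! 2) *s f [xs ! 0, xs ! 1]) \<Phi> = f [1, 1]"
proof -
  let ?f = "\<lambda>xs. \<epsilon> (xs ! 2) *s f [xs ! 0, xs ! 1]"
  have "multilinear 3 ?f"
    by (rule multilinear3I; simp; intro lin_counit_scale lin_scale multilinear_lin2 f)
  with coassociator_cancel_right[OF has_length_counit_leg(2) coassociator_counit_leg3]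
  have "?f [1, 1, 1] = lin_ext scale ?f counit_leg\<^sub>3"
    unfolding mequiv_def by (metis (no_types, lifting) lin_ext_pure)
  thus ?thesis by (simp add: lin_ext_counit_leg counit_one)
qed

section \<open>Zigzags absorb coproducts\<close>

text \<open>
  Invariance without signs, which is what invariance amounts to for even \<open>c\<close>. In this form the antipode axiom
  for \<open>\<beta>\<close> is an instance.
\<close>

definition right_invariant :: "'a \<Rightarrow> bool" where
  "right_invariant c \<longleftrightarrow> (\<forall>a. lin_ext scale (\<lambda>ps. ps ! 0 * c * S (ps ! 1)) (\<Delta> a) = \<epsilon> a *s c)"

lemma right_invariant_beta: "right_invariant \<beta>"
  using antipode_beta by (simp add: right_invariant_def eval2_def)

lemma right_invariant_if_invariant:
  assumes "c \<in> gr 0" "invariant c"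
  shows "right_invariant c"
proof -
  have "S (hcomp 0 y) + S (hcomp 1 y) = S y" for y
    using antipode_linear hcomp_add[of y] unfolding lin_iff by metis
  hence "(\<Sum>i\<in>{0, 1}. \<Sum>j\<in>{0, 1}. ksign i j *s (x * hcomp i c * S (hcomp j y))) = x * c * S y" for x y
    by (simp add: hcomp_homogeneous[OF assms(1)] flip: distrib_left)
  thus ?thesis
    using assms(2) by (simp add: invariant_def right_invariant_def eval2_def)
qed

definition zigzag :: "'a \<Rightarrow> 'a \<Rightarrow> 'a list \<Rightarrow> 'a" where
  "zigzag c b xs = xs ! 0 * c * S (xs ! 1) * \<alpha> * xs ! 2 * b * S (xs ! 3)"

lemma multilinear_zigzag: "multilinear 4 (zigzag c b)"
  unfolding zigzag_def
  by (rule multilinear4I; simp; intro lin_mult_left lin_mult_right lin_antipode lin_ident)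

text \<open>
  Both sides are multilinear in \<open>us\<close>, \<open>pre\<close> and \<open>post\<close> and linear in \<open>a\<close>, so the absorption of a coproduct
  need only be checked on homogeneous elements. The function \<open>H\<close> stands for a product with the
  coproduct in its left or in its right factor.
\<close>

lemma absorb_homogeneousI:
  assumes H: "\<And>us. length us = n \<Longrightarrow> multilinear n (\<lambda>ts. H ts us)"
      "\<And>ts. length ts = n \<Longrightarrow> multilinear n (H ts)"
    and len: "length pre = k" "length post = l" "k + 2 + l = n" "length us = n"
    and eq: "\<And>us es pre ds post fs a d. length us = n \<Longrightarrow> homogeneous_list us es \<Longrightarrow>
      length pre = k \<Longrightarrow> homogeneous_list pre ds \<Longrightarrow> length post = l \<Longrightarrow> homogeneous_list post fs \<Longrightarrow>
      a \<in> gr d \<Longrightarrow>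
      lin_ext scale (\<lambda>ps. H (pre @ ps @ post) us) (\<Delta> a) = \<epsilon> a *s H (pre @ [1, 1] @ post) us"
  shows "lin_ext scale (\<lambda>ps. H (pre @ ps @ post) us) (\<Delta> a) = \<epsilon> a *s H (pre @ [1, 1] @ post) us"
    (is "?L us a pre post = ?R us a pre post")
proof (rule multilinear_eq_homogeneousI[OF _ _ _ len(4), where f = "\<lambda>us. ?L us a pre post"])
  show "multilinear n (\<lambda>us. ?L us a pre post)"
    by (rule multilinear_lin_ext[OF comult_length], rule H(2)) (use len in simp)
  show "multilinear n (\<lambda>us. ?R us a pre post)"
    by (rule multilinear_scale, rule H(2)) (use len in simp)
  fix us es assume us: "length us = n" "homogeneous_list us es"
  note ml = multilinear_append_arg[OF H(1)[OF us(1)]]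
  show "?L us a pre post = ?R us a pre post"
  proof (rule lin_eq_homogeneousI[where a = a])
    show "lin (\<lambda>a. ?L us a pre post)"
      using len by (intro lin_comult ml) simp
    show "lin (\<lambda>a. ?R us a pre post)"
      by (intro lin_counit lin_ident)
    fix d a assume a: "a \<in> gr d"
    show "?L us a pre post = ?R us a pre post"
    proof (rule multilinear_eq_homogeneousI2[OF _ _ _ _ _ len(1,2)])
      show "multilinear k (\<lambda>pre. ?L us a pre post)" "multilinear k (\<lambda>pre. ?R us a pre post)"
        if "length post = l" for post
        using ml[of "[]" k "_ @ post"] ml[of "[]" k "[1, 1] @ post"] len that
        by (auto intro!: multilinear_lin_ext[OF comult_length] multilinear_scale)
      show "multilinear l (?L us a pre)" "multilinear l (?R us a pre)"
        if "length pre = k" for pre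
        using ml[of "pre @ _" l "[]"] ml[of "pre @ [1, 1]" l "[]"] len that
        by (auto intro!: multilinear_lin_ext[OF comult_length] multilinear_scale)
    qed (rule eq; use us a in auto)
  qed
qed

text \<open>
  For homogeneous entries, \<open>S(p t) \<alpha> (q u) = \<plusminus> S(t) (S(p) \<alpha> q) u\<close>, where \<open>p\<close>, \<open>q\<close> are the legs of \<open>\<Delta>(a)\<close>, and
  \<open>S(p) \<alpha> q\<close> sums to \<open>\<epsilon>(a) \<alpha>\<close>.
\<close>

lemma zigzag_absorb_middle:
  assumes "length us = 4"
  shows "lin_ext scale (\<lambda>ps. mval (zigzag c b) ([x] @ ps @ [z]) us) (\<Delta> a)
    = \<epsilon> a *s mval (zigzag c b) ([x] @ [1, 1] @ [z]) us"
proof (rule absorb_homogeneousI[where n = 4, OF _ _ _ _ _ assms])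
  note zz = multilinear_zigzag[of c b]
  show left: "multilinear 4 (\<lambda>ts. mval (zigzag c b) ts us)" if "length us = 4" for us
    by (rule multilinear_mval_left[OF zz that])
  show "multilinear 4 (mval (zigzag c b) ts)" if "length ts = 4" for ts
    by (rule multilinear_mval_right[OF zz that])
  fix us es pre ds post fs a d
  assume us: "length us = 4" "homogeneous_list us es"
    and pre: "length pre = 1" "homogeneous_list pre ds"
    and post: "length post = 1" "homogeneous_list post fs" and a: "a \<in> gr d"
  obtain s t u v e\<^sub>s e\<^sub>t e\<^sub>u e\<^sub>v where uv: "us = [s, t, u, v]" "es = [e\<^sub>s, e\<^sub>t, e\<^sub>u, e\<^sub>v]"
    "s \<in> gr e\<^sub>s" "t \<in> gr e\<^sub>t" "u \<in> gr e\<^sub>u" "v \<in> gr e\<^sub>v"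
    using us length_numeral_cases(3)[of us] by (auto simp: list_all2_Cons1)
  obtain x dx z dz where xz: "pre = [x]" "post = [z]" "x \<in> gr dx" "z \<in> gr dz"
    using pre post by (auto simp: length_Suc_conv list_all2_Cons1)
  \<comment> \<open>Both \<open>p\<close> and \<open>q\<close> pass \<open>s\<close>, and \<open>q\<close> passes \<open>t\<close>; the antipode makes \<open>p\<close> pass \<open>t\<close> as well.\<close>
  let ?k = "mult_sign [dx, 0, 0, dz] es * ksign d (e\<^sub>s + e\<^sub>t)"
  let ?L = "\<lambda>m. ?k *s (x * s * c * S t * m * u * b * S (z * v))"
  have "lin_ext scale (\<lambda>ps. mval (zigzag c b) (pre @ ps @ post) us) (\<Delta> a)
      = lin_ext scale (\<lambda>ps. ?L (S (ps ! 0) * \<alpha> * ps ! 1)) (\<Delta> a)"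
  proof (rule comult_homogeneous_eqI[OF a multilinear_append_arg[OF left[OF us(1)]]])
    show "multilinear 2 (\<lambda>ps. ?L (S (ps ! 0) * \<alpha> * ps ! 1))"
      by (rule multilinear2I; simp; intro lin_scale lin_mult_left lin_mult_right lin_antipode lin_ident)
    fix p q dp dq assume pq: "p \<in> gr dp" "q \<in> gr dq" and d: "d = dp + dq"
    have "mval (zigzag c b) (pre @ [p, q] @ post) us
        = mult_sign [dx, dp, dq, dz] es *s zigzag c b [x * s, p * t, q * u, z * v]"
      using xz pq uv us by (subst mval_homogeneous[OF zz]) auto
    also have "\<dots> = ?L (S ([p, q] ! 0) * \<alpha> * [p, q] ! 1)"
      using pq uv by (simp add: zigzag_def antipode_mult[OF pq(1) uv(4)] d mult_sign_4 ksign_add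
          scale_mult_left scale_mult_right mult_ac mult.assoc)
    finally show "mval (zigzag c b) (pre @ [p, q] @ post) us = ?L (S ([p, q] ! 0) * \<alpha> * [p, q] ! 1)" .
  qed (simp add: xz)
  also have "\<dots> = ?L (\<epsilon> a *s \<alpha>)"
  proof -
    have "lin ?L" by (intro lin_scale lin_mult_left lin_mult_right lin_ident)
    from lin_apply_lin_ext[OF this, symmetric] show ?thesis
      using antipode_alpha[of a] by (simp add: eval2_def)
  qed
  also have "\<dots> = \<epsilon> a *s mult_sign [dx, 0, 0, dz] es *s zigzag c b [x * s, 1 * t, 1 * u, z * v]"
    using counit_gr a by (cases d) (auto simp: zigzag_def scale_mult_left scale_mult_right mult.commute mult.assoc)
  also have "\<dots> = \<epsilon> a *s mval (zigzag c b) (pre @ [1, 1] @ post) us"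
    using xz uv us one_gr by (subst mval_homogeneous[OF zz]) auto
  finally show "lin_ext scale (\<lambda>ps. mval (zigzag c b) (pre @ ps @ post) us) (\<Delta> a)
    = \<epsilon> a *s mval (zigzag c b) (pre @ [1, 1] @ post) us" .
qed auto

text \<open>
  Here \<open>(s p) c S(t q) = \<plusminus> s (p c S(q)) S(t)\<close>, and \<open>p c S(q)\<close> sums to \<open>\<epsilon>(a) c\<close>.
\<close>

lemma zigzag_absorb_first:
  assumes c: "right_invariant c" and len: "length us = 4"
  shows "lin_ext scale (\<lambda>ps. mval (zigzag c b) us ([] @ ps @ [y, z])) (\<Delta> a)
    = \<epsilon> a *s mval (zigzag c b) us ([] @ [1, 1] @ [y, z])"
proof (rule absorb_homogeneousI[where n = 4 and H = "\<lambda>ts us. mval (zigzag c b) us ts", OF _ _ _ _ _ len])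
  note zz = multilinear_zigzag[of c b]
  show right: "multilinear 4 (mval (zigzag c b) us)" if "length us = 4" for us
    by (rule multilinear_mval_right[OF zz that])
  show "multilinear 4 (\<lambda>us. mval (zigzag c b) us ts)" if "length ts = 4" for ts
    by (rule multilinear_mval_left[OF zz that])
  fix us es pre ds post fs a d
  assume us: "length us = 4" "homogeneous_list us es"
    and pre: "length pre = 0" "homogeneous_list pre ds"
    and post: "length post = 2" "homogeneous_list post fs" and a: "a \<in> gr d"
  obtain s t u v e\<^sub>s e\<^sub>t e\<^sub>u e\<^sub>v where uv: "us = [s, t, u, v]" "es = [e\<^sub>s, e\<^sub>t, e\<^sub>u, e\<^sub>v]"
    "s \<in> gr e\<^sub>s" "t \<in> gr e\<^sub>t" "u \<in> gr e\<^sub>u" "v \<in> gr e\<^sub>v"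
    using us length_numeral_cases(3)[of us] by (auto simp: list_all2_Cons1)
  obtain y dy z dz where yz: "pre = []" "post = [y, z]" "y \<in> gr dy" "z \<in> gr dz"
    using pre post length_numeral_cases(1)[of post] by (auto simp: list_all2_Cons1)
  \<comment> \<open>Both \<open>p\<close> and \<open>q\<close> pass \<open>u\<close> and \<open>v\<close>, and \<open>p\<close> passes \<open>t\<close>; the antipode makes \<open>q\<close> pass \<open>t\<close> as well.\<close>
  let ?k = "mult_sign es [0, 0, dy, dz] * ksign (e\<^sub>t + e\<^sub>u + e\<^sub>v) d"
  let ?L = "\<lambda>m. ?k *s (s * m * S t * \<alpha> * (u * y) * b * S (v * z))"
  have "lin_ext scale (\<lambda>ps. mval (zigzag c b) us (pre @ ps @ post)) (\<Delta> a)
      = lin_ext scale (\<lambda>ps. ?L (ps ! 0 * c * S (ps ! 1))) (\<Delta> a)"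
  proof (rule comult_homogeneous_eqI[OF a multilinear_append_arg[OF right[OF us(1)]]])
    show "multilinear 2 (\<lambda>ps. ?L (ps ! 0 * c * S (ps ! 1)))"
      by (rule multilinear2I; simp; intro lin_scale lin_mult_left lin_mult_right lin_antipode lin_ident)
    fix p q dp dq assume pq: "p \<in> gr dp" "q \<in> gr dq" and d: "d = dp + dq"
    have "mval (zigzag c b) us (pre @ [p, q] @ post)
        = mult_sign es [dp, dq, dy, dz] *s zigzag c b [s * p, t * q, u * y, v * z]"
      using yz pq uv us by (subst mval_homogeneous[OF zz]) auto
    also have "\<dots> = ?L ([p, q] ! 0 * c * S ([p, q] ! 1))"
      using pq uv by (simp add: zigzag_def antipode_mult[OF uv(4) pq(2)] d mult_sign_4 ksign_add
          scale_mult_left scale_mult_right mult_ac mult.assoc)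
    finally show "mval (zigzag c b) us (pre @ [p, q] @ post) = ?L ([p, q] ! 0 * c * S ([p, q] ! 1))" .
  qed (simp add: yz)
  also have "\<dots> = ?L (\<epsilon> a *s c)"
  proof -
    have "lin ?L" by (intro lin_scale lin_mult_left lin_mult_right lin_ident)
    from lin_apply_lin_ext[OF this, symmetric] show ?thesis
      using c by (simp add: right_invariant_def)
  qed
  also have "\<dots> = \<epsilon> a *s mult_sign es [0, 0, dy, dz] *s zigzag c b [s * 1, t * 1, u * y, v * z]"
    using counit_gr a by (cases d) (auto simp: zigzag_def scale_mult_left scale_mult_right mult.commute mult.assoc)
  also have "\<dots> = \<epsilon> a *s mval (zigzag c b) us (pre @ [1, 1] @ post)"
    using yz uv us one_gr by (subst mval_homogeneous[OF zz]) auto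
  finally show "lin_ext scale (\<lambda>ps. mval (zigzag c b) us (pre @ ps @ post)) (\<Delta> a)
    = \<epsilon> a *s mval (zigzag c b) us (pre @ [1, 1] @ post)" .
qed auto

text \<open>
  The same for the last turn: \<open>(u p) b S(v q) = \<plusminus> u (p b S(q)) S(v)\<close>.
\<close>

lemma zigzag_absorb_last:
  assumes b: "right_invariant b" and len: "length us = 4"
  shows "lin_ext scale (\<lambda>ps. mval (zigzag c b) us ([x, y] @ ps @ [])) (\<Delta> a)
    = \<epsilon> a *s mval (zigzag c b) us ([x, y] @ [1, 1] @ [])"
proof (rule absorb_homogeneousI[where n = 4 and H = "\<lambda>ts us. mval (zigzag c b) us ts", OF _ _ _ _ _ len])
  note zz = multilinear_zigzag[of c b]
  show right: "multilinear 4 (mval (zigzag c b) us)" if "length us = 4" for us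
    by (rule multilinear_mval_right[OF zz that])
  show "multilinear 4 (\<lambda>us. mval (zigzag c b) us ts)" if "length ts = 4" for ts
    by (rule multilinear_mval_left[OF zz that])
  fix us es pre ds post fs a d
  assume us: "length us = 4" "homogeneous_list us es"
    and pre: "length pre = 2" "homogeneous_list pre ds"
    and post: "length post = 0" "homogeneous_list post fs" and a: "a \<in> gr d"
  obtain s t u v e\<^sub>s e\<^sub>t e\<^sub>u e\<^sub>v where uv: "us = [s, t, u, v]" "es = [e\<^sub>s, e\<^sub>t, e\<^sub>u, e\<^sub>v]"
    "s \<in> gr e\<^sub>s" "t \<in> gr e\<^sub>t" "u \<in> gr e\<^sub>u" "v \<in> gr e\<^sub>v"
    using us length_numeral_cases(3)[of us] by (auto simp: list_all2_Cons1)
  obtain x dx y dy where xy: "post = []" "pre = [x, y]" "x \<in> gr dx" "y \<in> gr dy"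
    using pre post length_numeral_cases(1)[of pre] by (auto simp: list_all2_Cons1)
  \<comment> \<open>The sign for \<open>p\<close> passing \<open>v\<close> comes from the product, the one for \<open>q\<close> from the antipode.\<close>
  let ?k = "mult_sign es [dx, dy, 0, 0] * ksign e\<^sub>v d"
  let ?L = "\<lambda>m. ?k *s (s * x * c * S (t * y) * \<alpha> * u * m * S v)"
  have "lin_ext scale (\<lambda>ps. mval (zigzag c b) us (pre @ ps @ post)) (\<Delta> a)
      = lin_ext scale (\<lambda>ps. ?L (ps ! 0 * b * S (ps ! 1))) (\<Delta> a)"
  proof (rule comult_homogeneous_eqI[OF a multilinear_append_arg[OF right[OF us(1)]]])
    show "multilinear 2 (\<lambda>ps. ?L (ps ! 0 * b * S (ps ! 1)))"
      by (rule multilinear2I; simp; intro lin_scale lin_mult_left lin_mult_right lin_antipode lin_ident)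
    fix p q dp dq assume pq: "p \<in> gr dp" "q \<in> gr dq" and d: "d = dp + dq"
    have "mval (zigzag c b) us (pre @ [p, q] @ post)
        = mult_sign es [dx, dy, dp, dq] *s zigzag c b [s * x, t * y, u * p, v * q]"
      using xy pq uv us by (subst mval_homogeneous[OF zz]) auto
    also have "\<dots> = ?L ([p, q] ! 0 * b * S ([p, q] ! 1))"
      using pq uv by (simp add: zigzag_def antipode_mult[OF uv(6) pq(2)] d mult_sign_4 ksign_add
          scale_mult_left scale_mult_right mult_ac mult.assoc)
    finally show "mval (zigzag c b) us (pre @ [p, q] @ post) = ?L ([p, q] ! 0 * b * S ([p, q] ! 1))" .
  qed (simp add: xy)
  also have "\<dots> = ?L (\<epsilon> a *s b)"
  proof -
    have "lin ?L" by (intro lin_scale lin_mult_left lin_mult_right lin_ident)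
    from lin_apply_lin_ext[OF this, symmetric] show ?thesis
      using b by (simp add: right_invariant_def)
  qed
  also have "\<dots> = \<epsilon> a *s mult_sign es [dx, dy, 0, 0] *s zigzag c b [s * x, t * y, u * 1, v * 1]"
    using counit_gr a by (cases d) (auto simp: zigzag_def scale_mult_left scale_mult_right mult.commute mult.assoc)
  also have "\<dots> = \<epsilon> a *s mval (zigzag c b) us (pre @ [1, 1] @ post)"
    using xy uv us one_gr by (subst mval_homogeneous[OF zz]) auto
  finally show "lin_ext scale (\<lambda>ps. mval (zigzag c b) us (pre @ ps @ post)) (\<Delta> a)
    = \<epsilon> a *s mval (zigzag c b) us (pre @ [1, 1] @ post)" .
qed auto

section \<open>The central element\<close>

text \<open>
  The cap is defined through the zigzag, so that it inherits the absorption of coproducts.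
\<close>

definition cap :: "'a \<Rightarrow> 'a list \<Rightarrow> 'a" where
  "cap c xs = zigzag c 1 (xs @ [1])"

lemma cap_simp: "cap c [x, y, z] = x * c * S y * \<alpha> * z"
  by (simp add: cap_def zigzag_def antipode_one)

lemma multilinear_cap: "multilinear 3 (cap c)"
  unfolding cap_def using multilinear_append_arg[OF multilinear_zigzag, of "[]" 3 "[1]" c 1] by simp

lemma mval_cap:
  "length xs = 3 \<Longrightarrow> length ys = 3 \<Longrightarrow> mval (cap c) xs ys = mval (zigzag c 1) (xs @ [1]) (ys @ [1])"
  unfolding cap_def using mval_append_one[of 3 "zigzag c 1"] multilinear_zigzag[of c 1] by simp

lemma mval_cap_outer:
  assumes len: "length us = 3"
  shows "mval (cap c) [x, 1, 1] us = x * cap c us" "mval (cap c) us [1, 1, z] = cap c us * z"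
proof -
  note ml = multilinear_cap[of c]
  show "mval (cap c) [x, 1, 1] us = x * cap c us"
  proof (rule multilinear_eq_homogeneousI[OF _ _ _ len])
    show "multilinear 3 (mval (cap c) [x, 1, 1])" by (rule multilinear_mval_right[OF ml]) simp
    show "multilinear 3 (\<lambda>us. x * cap c us)"
      by (rule multilinear_compose[OF _ ml]) (intro lin_mult_left lin_ident)
    fix us es assume us: "length us = 3" "homogeneous_list us es"
    show "mval (cap c) [x, 1, 1] us = x * cap c us"
    proof (rule lin_eq_homogeneousI[where a = x])
      show "lin (\<lambda>x. mval (cap c) [x, 1, 1] us)"
        by (intro multilinear_lin3(1) multilinear_mval_left[OF ml] us)
      show "lin (\<lambda>x. x * cap c us)" by (intro lin_mult_right lin_ident)
      fix d x assume "x \<in> gr d"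
      thus "mval (cap c) [x, 1, 1] us = x * cap c us"
        using us one_gr length_numeral_cases(2)[of us]
        by (subst mval_homogeneous[OF ml, of _ _ "[d, 0, 0]" es])
          (auto simp: list_all2_Cons1 mult_sign_3 cap_simp mult.assoc)
    qed
  qed
  show "mval (cap c) us [1, 1, z] = cap c us * z"
  proof (rule multilinear_eq_homogeneousI[OF _ _ _ len])
    show "multilinear 3 (\<lambda>us. mval (cap c) us [1, 1, z])" by (rule multilinear_mval_left[OF ml]) simp
    show "multilinear 3 (\<lambda>us. cap c us * z)"
      by (rule multilinear_compose[OF _ ml]) (intro lin_mult_right lin_ident)
    fix us es assume us: "length us = 3" "homogeneous_list us es"
    show "mval (cap c) us [1, 1, z] = cap c us * z"
    proof (rule lin_eq_homogeneousI[where a = z])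
      show "lin (\<lambda>z. mval (cap c) us [1, 1, z])"
        by (intro multilinear_lin3(3) multilinear_mval_right[OF ml] us)
      show "lin (\<lambda>z. cap c us * z)" by (intro lin_mult_left lin_ident)
      fix d z assume "z \<in> gr d"
      thus "mval (cap c) us [1, 1, z] = cap c us * z"
        using us one_gr length_numeral_cases(2)[of us]
        by (subst mval_homogeneous[OF ml, of _ _ es "[0, 0, d]"])
          (auto simp: list_all2_Cons1 mult_sign_3 cap_simp mult.assoc)
    qed
  qed
qed

lemma cap_absorb:
  assumes len: "length us = 3"
  shows "lin_ext scale (\<lambda>ps. mval (cap c) (x # ps) us) (\<Delta> a) = \<epsilon> a *s (x * cap c us)"
    and "right_invariant c \<Longrightarrow>
      lin_ext scale (\<lambda>ps. mval (cap c) us (ps @ [z])) (\<Delta> a) = \<epsilon> a *s (cap c us * z)"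
proof -
  have "lin_ext scale (\<lambda>ps. mval (cap c) (x # ps) us) (\<Delta> a)
      = lin_ext scale (\<lambda>ps. mval (zigzag c 1) ([x] @ ps @ [1]) (us @ [1])) (\<Delta> a)"
    using len by (intro lin_ext_cong_2[OF comult_length]) (simp add: mval_cap)
  also have "\<dots> = \<epsilon> a *s mval (cap c) [x, 1, 1] us"
    using len by (subst zigzag_absorb_middle) (simp_all add: mval_cap)
  finally show "lin_ext scale (\<lambda>ps. mval (cap c) (x # ps) us) (\<Delta> a) = \<epsilon> a *s (x * cap c us)"
    by (simp only: mval_cap_outer[OF len])
  assume c: "right_invariant c"
  have "lin_ext scale (\<lambda>ps. mval (cap c) us (ps @ [z])) (\<Delta> a)
      = lin_ext scale (\<lambda>ps. mval (zigzag c 1) (us @ [1]) ([] @ ps @ [z, 1])) (\<Delta> a)"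
    using len by (intro lin_ext_cong_2[OF comult_length]) (simp add: mval_cap)
  also have "\<dots> = \<epsilon> a *s mval (cap c) us [1, 1, z]"
    using len by (subst zigzag_absorb_first[OF c]) (simp_all add: mval_cap)
  finally show "lin_ext scale (\<lambda>ps. mval (cap c) us (ps @ [z])) (\<Delta> a) = \<epsilon> a *s (cap c us * z)"
    by (simp only: mval_cap_outer[OF len])
qed

lemma quasi_coassoc_coassociator_inverse:
  "mequiv 3 (tmap [id_leg, \<Delta>] (\<Delta> a) \<bullet> \<Phi>inv) (\<Phi>inv \<bullet> tmap [\<Delta>, id_leg] (\<Delta> a))"
proof -
  let ?l = "tmap [id_leg, \<Delta>] (\<Delta> a)" and ?r = "tmap [\<Delta>, id_leg] (\<Delta> a)"
  note \<Phi> = coassociator_length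
  have l: "has_length 3 ?l" and r: "has_length 3 ?r"
    using has_length_tmap[OF comult_length, of "[id_leg, \<Delta>]" "[1, 2]"]
      has_length_tmap[OF comult_length, of "[\<Delta>, id_leg]" "[2, 1]"]
    by (simp_all add: comult_length comult_length[unfolded numeral_2_eq_2] numeral_eq_Suc)
  have one: "mequiv 3 (\<Phi>inv \<bullet> ?r \<bullet> pure [1, 1, 1]) (\<Phi>inv \<bullet> ?r)"
    using mequiv_tmult_one(1)[OF has_length_tmult[OF \<Phi>(2) r]] by (simp add: numeral_eq_Suc)
  have "mequiv 3 ?l (\<Phi>inv \<bullet> ?r \<bullet> \<Phi>)"
    by (intro mequiv_teq has_length_tmult l r \<Phi> quasi_coassoc)
  hence "mequiv 3 (?l \<bullet> \<Phi>inv) (\<Phi>inv \<bullet> ?r \<bullet> \<Phi> \<bullet> \<Phi>inv)"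
    by (intro mequiv_tmult l \<Phi>) (simp_all add: mequiv_def)
  also have "mequiv 3 (\<Phi>inv \<bullet> ?r \<bullet> \<Phi> \<bullet> \<Phi>inv) (\<Phi>inv \<bullet> ?r \<bullet> (\<Phi> \<bullet> \<Phi>inv))"
    by (intro mequiv_tmult_assoc has_length_tmult \<Phi> r)
  also have "mequiv 3 (\<Phi>inv \<bullet> ?r \<bullet> (\<Phi> \<bullet> \<Phi>inv)) (\<Phi>inv \<bullet> ?r \<bullet> pure [1, 1, 1])"
    using mequiv_coassociator_inverse(1)
    by (intro mequiv_tmult has_length_tmult \<Phi> r) (simp_all add: mequiv_def)
  also note one
  finally show ?thesis .
qed

text \<open>
  Absorbing the inner coproduct of \<open>(1 \<otimes> \<Delta>)\<Delta>(a)\<close> or of \<open>(\<Delta> \<otimes> 1)\<Delta>(a)\<close> leaves \<open>\<epsilon>\<close> on one leg of \<open>\<Delta>(a)\<close>. The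
  other leg is \<open>a\<close>, and it stands to the left or to the right of the value at \<open>\<Phi>inv\<close>.
\<close>

lemma cap_central:
  assumes c: "right_invariant c"
  shows "a * lin_ext scale (cap c) \<Phi>inv = lin_ext scale (cap c) \<Phi>inv * a"
proof -
  let ?C = "lin_ext scale (cap c) \<Phi>inv"
  note \<Psi> = coassociator_length(2)
  have "lin_ext scale (cap c) (tmap [id_leg, \<Delta>] (\<Delta> a) \<bullet> \<Phi>inv)
      = lin_ext scale (\<lambda>as. lin_ext scale (\<lambda>ps. lin_ext scale (mval (cap c) (as ! 0 # ps)) \<Phi>inv) (\<Delta> (as ! 1))) (\<Delta> a)"
    unfolding lin_ext_tmult tmap_def lin_ext_lin_ext
    by (rule lin_ext_cong_2[OF comult_length]) (simp add: lin_ext_tprod)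
  also have "\<dots> = lin_ext scale (\<lambda>as. \<epsilon> (as ! 1) *s (as ! 0 * ?C)) (\<Delta> a)"
  proof (rule lin_ext_cong_2[OF comult_length])
    fix x y
    have "lin_ext scale (\<lambda>ps. lin_ext scale (mval (cap c) (x # ps)) \<Phi>inv) (\<Delta> y)
        = lin_ext scale (\<lambda>us. lin_ext scale (\<lambda>ps. mval (cap c) (x # ps) us) (\<Delta> y)) \<Phi>inv"
      by (rule lin_ext_swap)
    also have "\<dots> = lin_ext scale (\<lambda>us. \<epsilon> y *s (x * cap c us)) \<Phi>inv"
      by (rule lin_ext_cong_length[OF \<Psi>]) (rule cap_absorb(1))
    also have "\<dots> = \<epsilon> y *s (x * ?C)"
      by (rule lin_apply_lin_ext[symmetric]) (intro lin_scale lin_mult_left lin_ident)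
    finally show "lin_ext scale (\<lambda>ps. lin_ext scale (mval (cap c) ([x, y] ! 0 # ps)) \<Phi>inv) (\<Delta> ([x, y] ! 1))
        = \<epsilon> ([x, y] ! 1) *s ([x, y] ! 0 * ?C)" by simp
  qed
  also have "\<dots> = a * ?C"
    by (rule lin_ext_comult_counit(2)) (intro lin_mult_right lin_ident)
  finally have left: "lin_ext scale (cap c) (tmap [id_leg, \<Delta>] (\<Delta> a) \<bullet> \<Phi>inv) = a * ?C" .
  have "lin_ext scale (cap c) (\<Phi>inv \<bullet> tmap [\<Delta>, id_leg] (\<Delta> a)) = lin_ext scale (\<lambda>us. cap c us * a) \<Phi>inv"
    unfolding lin_ext_tmult
  proof (rule lin_ext_cong_length[OF \<Psi>])
    fix us :: "'a list" assume us: "length us = 3"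
    have "lin_ext scale (mval (cap c) us) (tmap [\<Delta>, id_leg] (\<Delta> a))
        = lin_ext scale (\<lambda>as. \<epsilon> (as ! 0) *s (cap c us * as ! 1)) (\<Delta> a)"
      unfolding tmap_def lin_ext_lin_ext
      by (rule lin_ext_cong_2[OF comult_length]) (simp add: lin_ext_tprod cap_absorb(2)[OF us c])
    also have "\<dots> = cap c us * a"
      by (rule lin_ext_comult_counit(1)) (intro lin_mult_left lin_ident)
    finally show "lin_ext scale (mval (cap c) us) (tmap [\<Delta>, id_leg] (\<Delta> a)) = cap c us * a" .
  qed
  also have "\<dots> = ?C * a"
    by (rule lin_apply_lin_ext[symmetric]) (intro lin_mult_right lin_ident)
  finally show ?thesis
    using left quasi_coassoc_coassociator_inverse[of a] multilinear_cap[of c] by (simp add: mequiv_def)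
qed

text \<open>
  In this form of the pentagon equation all coproducts are on the side from which a zigzag absorbs
  them.
\<close>

lemma pentagon_coassociator_inverse:
  "mequiv 4 ((\<Phi>inv \<otimes>\<^sub>t pure [1]) \<bullet> \<Delta>\<^sub>1 \<bullet> \<Delta>\<^sub>3) (\<Delta>\<^sub>2 \<bullet> (pure [1] \<otimes>\<^sub>t \<Phi>))"
proof -
  let ?\<Phi> = "\<Phi> \<otimes>\<^sub>t pure [1]" and ?\<Psi> = "\<Phi>inv \<otimes>\<^sub>t pure [1]" and ?\<Phi>' = "pure [1] \<otimes>\<^sub>t \<Phi>"
  note D = has_length_comult_leg
  have L: "has_length 4 ?\<Phi>" "has_length 4 ?\<Phi>'" "has_length 4 ?\<Psi>"
    using has_length_pad[OF coassociator_length(1)] has_length_pad[OF coassociator_length(2)] by simp_all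
  have refl: "mequiv 4 t t" for t by (simp add: mequiv_def)
  have inv: "mequiv 4 (?\<Psi> \<bullet> ?\<Phi>) (pure [1, 1, 1, 1])"
    unfolding mequiv_def
  proof (intro allI impI)
    fix f assume f: "multilinear 4 f"
    let ?f = "\<lambda>us. f (us @ [1])"
    have f': "multilinear 3 ?f"
      using multilinear_append_arg[OF f, of "[]" 3 "[1]"] by simp
    have "lin_ext scale f (?\<Psi> \<bullet> ?\<Phi>) = lin_ext scale (\<lambda>xs. lin_ext scale (\<lambda>ys. mval f (xs @ [1]) (ys @ [1])) \<Phi>) \<Phi>inv"
      by (simp add: lin_ext_tmult lin_ext_tprod)
    also have "\<dots> = lin_ext scale ?f (\<Phi>inv \<bullet> \<Phi>)"
      unfolding lin_ext_tmult
      by (intro lin_ext_cong_length[OF coassociator_length(2)] lin_ext_cong_length[OF coassociator_length(1)]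
          mval_append_one[where n = 3]) (use f in simp_all)
    also have "\<dots> = f [1, 1, 1, 1]"
      using mequiv_coassociator_inverse(2) f' by (simp add: mequiv_def)
    finally show "lin_ext scale f (?\<Psi> \<bullet> ?\<Phi>) = lin_ext scale f (pure [1, 1, 1, 1])" by simp
  qed
  have one: "mequiv 4 (pure [1, 1, 1, 1] \<bullet> (\<Delta>\<^sub>2 \<bullet> ?\<Phi>')) (\<Delta>\<^sub>2 \<bullet> ?\<Phi>')"
    using mequiv_tmult_one(2)[OF has_length_tmult[OF D(2) L(2)]] by (simp add: numeral_eq_Suc)
  have "mequiv 4 (?\<Psi> \<bullet> \<Delta>\<^sub>1 \<bullet> \<Delta>\<^sub>3) (?\<Psi> \<bullet> (\<Delta>\<^sub>1 \<bullet> \<Delta>\<^sub>3))"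
    by (intro mequiv_tmult_assoc L D)
  also have "mequiv 4 (?\<Psi> \<bullet> (\<Delta>\<^sub>1 \<bullet> \<Delta>\<^sub>3)) (?\<Psi> \<bullet> (?\<Phi> \<bullet> \<Delta>\<^sub>2 \<bullet> ?\<Phi>'))"
    by (intro mequiv_tmult has_length_tmult L D mequiv_pentagon refl)
  also have "mequiv 4 (?\<Psi> \<bullet> (?\<Phi> \<bullet> \<Delta>\<^sub>2 \<bullet> ?\<Phi>')) (?\<Psi> \<bullet> (?\<Phi> \<bullet> (\<Delta>\<^sub>2 \<bullet> ?\<Phi>')))"
    by (intro mequiv_tmult has_length_tmult L D mequiv_tmult_assoc refl)
  also have "mequiv 4 (?\<Psi> \<bullet> (?\<Phi> \<bullet> (\<Delta>\<^sub>2 \<bullet> ?\<Phi>'))) (?\<Psi> \<bullet> ?\<Phi> \<bullet> (\<Delta>\<^sub>2 \<bullet> ?\<Phi>'))"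
    by (intro mequiv_sym[OF mequiv_tmult_assoc] has_length_tmult L D)
  also have "mequiv 4 (?\<Psi> \<bullet> ?\<Phi> \<bullet> (\<Delta>\<^sub>2 \<bullet> ?\<Phi>')) (pure [1, 1, 1, 1] \<bullet> (\<Delta>\<^sub>2 \<bullet> ?\<Phi>'))"
    by (intro mequiv_tmult has_length_tmult L D inv refl)
  also note one
  finally show ?thesis .
qed

text \<open>
  Absorption replaces the factor by \<open>\<Phi>\<close> with \<open>\<epsilon>\<close> on its first or last leg.
\<close>

lemma zigzag_comult_right:
  assumes c: "right_invariant c" and b: "right_invariant b" and us: "length us = 4"
  shows "lin_ext scale (mval (zigzag c b) us) \<Delta>\<^sub>1 = zigzag c b us"
    "lin_ext scale (mval (zigzag c b) us) \<Delta>\<^sub>3 = zigzag c b us"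
proof -
  note zz = multilinear_zigzag[of c b]
  note ml = multilinear_mval_right[OF zz us]
  have "lin_ext scale (mval (zigzag c b) us) \<Delta>\<^sub>1
      = lin_ext scale (\<lambda>xs. \<epsilon> (xs ! 0) *s (\<lambda>ys. mval (zigzag c b) us ([1, 1] @ ys)) [xs ! 1, xs ! 2]) \<Phi>"
    unfolding lin_ext_comult_leg using zigzag_absorb_first[OF c us]
    by (intro lin_ext_cong_3[OF coassociator_length(1)]) simp
  also have "\<dots> = mval (zigzag c b) us ([1, 1] @ [1, 1])"
    using multilinear_append_arg[OF ml, of "[1, 1]" 2 "[]"]
    by (intro lin_ext_coassociator_counit_first) simp
  finally show "lin_ext scale (mval (zigzag c b) us) \<Delta>\<^sub>1 = zigzag c b us"
    using mval_one_4[OF zz us] by simp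
  have "lin_ext scale (mval (zigzag c b) us) \<Delta>\<^sub>3
      = lin_ext scale (\<lambda>xs. \<epsilon> (xs ! 2) *s (\<lambda>ys. mval (zigzag c b) us (ys @ [1, 1])) [xs ! 0, xs ! 1]) \<Phi>"
    unfolding lin_ext_comult_leg using zigzag_absorb_last[OF b us]
    by (intro lin_ext_cong_3[OF coassociator_length(1)]) simp
  also have "\<dots> = mval (zigzag c b) us ([1, 1] @ [1, 1])"
    using multilinear_append_arg[OF ml, of "[]" 2 "[1, 1]"]
    by (intro lin_ext_coassociator_counit_last) simp
  finally show "lin_ext scale (mval (zigzag c b) us) \<Delta>\<^sub>3 = zigzag c b us"
    using mval_one_4[OF zz us] by simp
qed

lemma zigzag_comult_left:
  assumes t: "has_length 4 t"
  shows "lin_ext scale (zigzag c b) (\<Delta>\<^sub>2 \<bullet> t) = lin_ext scale (zigzag c b) t"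
proof -
  note zz = multilinear_zigzag[of c b]
  let ?h = "\<lambda>xs. lin_ext scale (mval (zigzag c b) ([xs ! 0] @ [1, 1] @ [xs ! 1])) t"
  have "lin_ext scale (zigzag c b) (\<Delta>\<^sub>2 \<bullet> t)
      = lin_ext scale (\<lambda>us. lin_ext scale (\<lambda>ts. mval (zigzag c b) ts us) \<Delta>\<^sub>2) t"
    unfolding lin_ext_tmult by (rule lin_ext_swap)
  also have "\<dots> = lin_ext scale (zigzag c b) t"
  proof (rule lin_ext_cong_length[OF t])
    fix us :: "'a list" assume us: "length us = 4"
    note ml = multilinear_mval_left[OF zz us]
    have "lin_ext scale (\<lambda>ts. mval (zigzag c b) ts us) \<Delta>\<^sub>2
        = lin_ext scale (\<lambda>xs. \<epsilon> (xs ! 1) *s (\<lambda>ys. mval (zigzag c b) ([ys ! 0] @ [1, 1] @ [ys ! 1]) us) [xs ! 0, xs ! 2]) \<Phi>"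
      unfolding lin_ext_comult_leg using zigzag_absorb_middle[OF us]
      by (intro lin_ext_cong_3[OF coassociator_length(1)]) simp
    also have "\<dots> = mval (zigzag c b) ([1] @ [1, 1] @ [1]) us"
    proof -
      have "multilinear 2 (\<lambda>ys. mval (zigzag c b) ([ys ! 0] @ [1, 1] @ [ys ! 1]) us)"
        using multilinear_lin[OF ml, of "[]" "[1, 1, _]"] multilinear_lin[OF ml, of "[_, 1, 1]" "[]"]
        by (intro multilinear2I) simp_all
      from lin_ext_coassociator_counit[OF this] show ?thesis by simp
    qed
    finally show "lin_ext scale (\<lambda>ts. mval (zigzag c b) ts us) \<Delta>\<^sub>2 = zigzag c b us"
      using mval_one_4[OF zz us] by simp
  qed
  finally show ?thesis .
qed

text \<open>
  The zigzag with \<open>b = \<beta>\<close> is evaluated at both sides of the pentagon equation. The factor \<open>\<beta>\<close> is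
  admissible in the last turn by the antipode axiom for \<open>\<beta>\<close>.
\<close>

lemma cap_beta:
  assumes c: "right_invariant c"
  shows "c = lin_ext scale (cap c) \<Phi>inv * \<beta>"
proof -
  let ?z = "zigzag c \<beta>" and ?\<Psi> = "\<Phi>inv \<otimes>\<^sub>t pure [1]"
  note zz = multilinear_zigzag[of c \<beta>]
  have L: "has_length 4 (pure [1] \<otimes>\<^sub>t \<Phi>)" "has_length 4 ?\<Psi>"
    using has_length_pad[OF coassociator_length(1)] has_length_pad[OF coassociator_length(2)] by simp_all
  have "lin_ext scale ?z (?\<Psi> \<bullet> \<Delta>\<^sub>1 \<bullet> \<Delta>\<^sub>3) = lin_ext scale ?z (?\<Psi> \<bullet> \<Delta>\<^sub>1)"
    unfolding lin_ext_tmult[of _ "?\<Psi> \<bullet> \<Delta>\<^sub>1"]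
    by (rule lin_ext_cong_length[OF has_length_tmult[OF L(2) has_length_comult_leg(1)]])
      (rule zigzag_comult_right[OF c right_invariant_beta])
  also have "\<dots> = lin_ext scale ?z ?\<Psi>"
    unfolding lin_ext_tmult
    by (rule lin_ext_cong_length[OF L(2)]) (rule zigzag_comult_right[OF c right_invariant_beta])
  also have "\<dots> = lin_ext scale (\<lambda>xs. cap c xs * \<beta>) \<Phi>inv"
    unfolding lin_ext_tprod
    by (rule lin_ext_cong_3[OF coassociator_length(2)]) (simp add: cap_simp zigzag_def antipode_one)
  also have "\<dots> = lin_ext scale (cap c) \<Phi>inv * \<beta>"
    by (rule lin_apply_lin_ext[symmetric]) (intro lin_mult_right lin_ident)
  finally have left: "lin_ext scale ?z (?\<Psi> \<bullet> \<Delta>\<^sub>1 \<bullet> \<Delta>\<^sub>3) = lin_ext scale (cap c) \<Phi>inv * \<beta>" .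
  have "lin_ext scale ?z (\<Delta>\<^sub>2 \<bullet> (pure [1] \<otimes>\<^sub>t \<Phi>)) = lin_ext scale ?z (pure [1] \<otimes>\<^sub>t \<Phi>)"
    by (rule zigzag_comult_left[OF L(1)])
  also have "\<dots> = lin_ext scale (\<lambda>xs. c * (S (xs ! 0) * \<alpha> * xs ! 1 * \<beta> * S (xs ! 2))) \<Phi>"
    unfolding lin_ext_tprod lin_ext_pure
    by (rule lin_ext_cong_3[OF coassociator_length(1)]) (simp add: zigzag_def mult.assoc)
  also have "\<dots> = c * lin_ext scale (\<lambda>xs. S (xs ! 0) * \<alpha> * xs ! 1 * \<beta> * S (xs ! 2)) \<Phi>"
    by (rule lin_apply_lin_ext[symmetric]) (intro lin_mult_left lin_ident)
  also have "\<dots> = c"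
    using antipode_coassociator by (simp add: eval3_def)
  finally show ?thesis
    using left pentagon_coassociator_inverse zz by (simp add: mequiv_def)
qed

lemma cap_central_element:
  assumes "c \<in> gr 0" "invariant c" and C: "C = eval3 (\<lambda>x y z. x * c * S y * \<alpha> * z) \<Phi>inv"
  shows "a * C = C * a" "c = C * \<beta>" "C = eval3 (\<lambda>x y z. S x * \<alpha> * y * c * S z) \<Phi>"
proof -
  have c: "right_invariant c"
    by (rule right_invariant_if_invariant[OF assms(1,2)])
  have C': "C = lin_ext scale (cap c) \<Phi>inv"
    unfolding C eval3_def by (rule lin_ext_cong_3[OF coassociator_length(2)]) (simp add: cap_simp)
  show central: "a * C = C * a" for a
    unfolding C' by (rule cap_central[OF c])
  show beta: "c = C * \<beta>"
    unfolding C' by (rule cap_beta[OF c])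
  have "S x * \<alpha> * y * c * S z = C * (S x * \<alpha> * y * \<beta> * S z)" for x y z
    by (subst beta) (metis central mult.assoc)
  hence "eval3 (\<lambda>x y z. S x * \<alpha> * y * c * S z) \<Phi>
      = lin_ext scale (\<lambda>xs. C * (S (xs ! 0) * \<alpha> * xs ! 1 * \<beta> * S (xs ! 2))) \<Phi>"
    by (simp add: eval3_def)
  also have "\<dots> = C * eval3 (\<lambda>x y z. S x * \<alpha> * y * \<beta> * S z) \<Phi>"
    unfolding eval3_def by (rule lin_apply_lin_ext[symmetric]) (intro lin_mult_left lin_ident)
  finally show "C = eval3 (\<lambda>x y z. S x * \<alpha> * y * c * S z) \<Phi>"
    by (simp add: antipode_coassociator)
qed

end

theorem proposition1:
  fixes scale :: "'k::field \<Rightarrow> 'a::ring_1 \<Rightarrow> 'a"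
    and gr :: "bit \<Rightarrow> 'a set"
    and \<Delta> :: "'a \<Rightarrow> ('a, 'k) tensor"
    and \<epsilon> :: "'a \<Rightarrow> 'k"
    and \<Phi> \<Phi>inv :: "('a, 'k) tensor"
    and S :: "'a \<Rightarrow> 'a"
    and \<alpha> \<beta> c\<^sub>1 C\<^sub>1 :: 'a
  assumes "quasi_hopf_superalgebra scale gr \<Delta> \<epsilon> \<Phi> \<Phi>inv S \<alpha> \<beta>"
    and "c\<^sub>1 \<in> gr 0"
    and "quasi_hopf_superalgebra.invariant scale gr \<Delta> \<epsilon> S c\<^sub>1"
    and "C\<^sub>1 = superalgebra.eval3 scale (\<lambda>x y z. x * c\<^sub>1 * S y * \<alpha> * z) \<Phi>inv"
  shows "(\<forall>a. a * C\<^sub>1 = C\<^sub>1 * a)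
    \<and> (c\<^sub>1 = C\<^sub>1 * \<beta> \<and> C\<^sub>1 * \<beta> = \<beta> * C\<^sub>1)
    \<and> C\<^sub>1 = superalgebra.eval3 scale (\<lambda>x y z. S x * \<alpha> * y * c\<^sub>1 * S z) \<Phi>"
proof -
  interpret quasi_hopf_superalgebra scale gr \<Delta> \<epsilon> \<Phi> \<Phi>inv S \<alpha> \<beta>
    by (fact assms(1))
  from cap_central_element[OF assms(2-4)] show ?thesis
    by metis
qed

end
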